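(* Let $\mathcal{M}=\langle\mathcal{X},X_W,\Phi,\mathcal{B}\rangle$ be a system of constraints with $\mathcal{B}=\langle V,F,E\rangle$, and let $h:\mathcal{X}_W\to\mathcal{X}_{V\setminus W}$ be a solution of $\mathcal{M}$; write $X^*_w=X_w$ for $w\in W$ and $X^*_{V\setminus W}=h(X_W)$. Let $\langle T_I,T_C,T_O\rangle$ be the coarse decomposition of the subgraph of $\mathcal{B}$ induced by $(V\setminus W)\cup F$, let $\mathrm{MO}_{\mathrm{CO}}(\mathcal{B})$ be the subgraph of the Markov ordering graph $\mathrm{MO}(\mathcal{B})$ induced by $((T_C\cup T_O)\cap V)\cup W$, and let $X^*_{\mathrm{CO}}$ be the corresponding components of $X^*$. If $\mathcal{M}$ is maximally uniquely solvable, then $(\mathrm{MO}_{\mathrm{CO}}(\mathcal{B}),\mathbb{P}_{X^*_{\mathrm{CO}}})$ satisfies the directed global Markov property: for all subsets $A,B,C$ of the vertex set of $\mathrm{MO}_{\mathrm{CO}}(\mathcal{B})$, if $A$ and $B$ are d-separated by $C$ in $\mathrm{MO}_{\mathrm{CO}}(\mathcal{B})$ then $X^*_A$ is independent of $X^*_B$ given $X^*_C$.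
   Context: System of constraints $\langle\mathcal{X},X_W,\Phi,\mathcal{B}\rangle$: $\mathcal{X}=\bigotimes_{v\in V}\mathcal{X}_v$ with each $\mathcal{X}_v$ a standard measurable space; $W\subseteq V$ (exogenous indices) and $X_W=(X_w)_{w\in W}$ independent random variables with values in $\mathcal{X}_W$; $\Phi=(\Phi_f)_{f\in F}$ with $\Phi_f=\langle\phi_f,c_f,V(f)\rangle$, $V(f)\subseteq V$, $c_f$ a constant in a standard measurable space $\mathcal{Y}$, $\phi_f:\mathcal{X}_{V(f)}\to\mathcal{Y}$ measurable; $\mathcal{B}=\langle V,F,E\rangle$ bipartite with $E=\{(f-v):v\in V(f)\}$. For $S_F\subseteq F$, $V(S_F)=\bigcup_{f\in S_F}V(f)$. A solution is a measurable $g:\mathcal{X}_W\to\mathcal{X}_{V\setminus W}$ with $\phi_f(g_{V(f)\setminus W}(X_W),X_{V(f)\cap W})=c_f$ for all $f\in F$, almost surely. $\mathcal{M}$ is solvable w.r.t. $S_F\subseteq F$ and $S_V\subseteq V(S_F)\setminus W$ if there is a measurable $g_{S_V}:\mathcal{X}_{V(S_F)\setminus S_V}\to\mathcal{X}_{S_V}$ such that, $\mathbb{P}_{X_W}$-a.s., for all $x_{V(S_F)\setminus W}$: $x_{S_V}=g_{S_V}(x_{V(S_F)\setminus(S_V\cup W)},X_{V(S_F)\cap W})$ implies $\phi_f(x_{V(f)\setminus W},X_{V(f)\cap W})=c_f$ for all $f\in S_F$; it is uniquely solvable w.r.t. $S_F,S_V$ if moreover the converse implication holds. Graph notions: $\mathrm{adj}_{\mathcal{B}}(X)$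 is the set of neighbours of $X$; $F'\subseteq F$ is self-contained if $|F'|=|\mathrm{adj}(F')|$ and $|F''|\le|\mathrm{adj}(F'')|$ for all $F''\subseteq F'$; a bipartite graph is self-contained if it has equally many vertices on both sides and its constraint side is self-contained; minimal self-contained = non-empty self-contained with no non-empty strict self-contained subset. Matching, maximum matching as usual; an alternating path for a matching $M$ is a sequence of distinct vertices (possibly one) with consecutive vertices adjacent and edges alternating between not in $M$ and in $M$. Coarse decomposition of a bipartite graph w.r.t. a maximum matching $M$: $T_I$ = vertices joined by an alternating path to an $M$-unmatched variable vertex, $T_O$ = vertices joined by an alternating path to an $M$-unmatched constraint vertex, $T_C$ = the rest (independent of $M$). Causal ordering graph $\mathrm{CO}(\mathcal{B})=\langle\mathcal{V},\mathcal{E}\rangle$ (Algorithm 3), a directed cluster graph (partition $\mathcal{V}$ of $V\cup F$ plus edges from vertices to clusters; $\mathrm{cl}(x)$ is the cluster of $x$): let $\mathcal{B}'$ be the subgraph induced by $(V\setminus W)\cup F$, $\langle T_I,T_C,T_O\rangle$ its coarse decomposition, $\mathcal{B}_I,\mathcal{B}_C,\mathcal{B}_O$ the induced subgraphs. Compute $\langle\mathcal{V}_C,\mathcal{E}_C\rangle$ by Algorithm 1 on $\mathcal{B}_C$: start with no clusters and edges, and while the current graph $\mathcal{B}''$ is non-null, choose a minimal self-contained set $S_F$ of $\mathcal{B}''$, form the cluster $C=S_F\cup\mathrm{adj}_{\mathcal{B}''}(S_F)$, add edges $v\to C$ for $v\in\mathrm{adj}_{\mathcal{B}_C}(S_F)\setminus\mathrm{adj}_{\mathcal{B}''}(S_F)$,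 and remove $C$. Let $\mathcal{V}=\mathcal{V}_C\cup\{\text{connected components of }\mathcal{B}_I\}\cup\{\text{connected components of }\mathcal{B}_O\}\cup\{\{w\}:w\in W\}$, $\mathcal{E}=\mathcal{E}_C$ plus: $v\to\mathrm{cl}(f)$ for each edge $(v-f)$ with $v\in(T_O\cup T_C)\cap V$, $f\in T_I\cap F$, or with $v\in T_O\cap V$, $f\in T_C\cap F$; and $w\to\mathrm{cl}(f)$ for each $w\in W$ and $f\in\mathrm{adj}_{\mathcal{B}}(w)$. $\mathcal{M}$ is maximally uniquely solvable if it is uniquely solvable w.r.t. $S\cap F$ and $S\cap V$ for every cluster $S\in\mathcal{V}$ with $S\cap W=\emptyset$ and $S\cap T_I=\emptyset$, and solvable w.r.t. $T_I\cap F$ and $(T_I\cap V)\setminus W$. Declustering: for a directed cluster graph $\langle\mathcal{V},\mathcal{E}\rangle$, $D(\langle\mathcal{V},\mathcal{E}\rangle)$ is the directed graph on $\bigcup\mathcal{V}$ with $x\to y$ iff $(x\to\mathrm{cl}(y))\in\mathcal{E}$. Marginalization (latent projection) of a set $U$ from a directed graph $\mathcal{G}$ gives the directed mixed graph on the remaining vertices with $x\to y$ iff $\mathcal{G}$ has a directed path from $x$ to $y$ all of whose intermediate vertices lie in $U$, and $x\leftrightarrow y$ iff $\mathcal{G}$ has a path $x\leftarrow u_1\leftarrow\dots\leftarrow u_i\to\dots\to u_k\to y$ with all $u_j\in U$. The Markov ordering graph is $\mathrm{MO}(\mathcal{B})=D(\mathrm{CO}(\mathcal{B}))$ with $F$ marginalized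 out. d-separation is the standard notion. *)

theory Defs
  imports "HOL-Probability.Probability"
begin

definition standard_measurable_space :: "'a measure \<Rightarrow> bool" where
  "standard_measurable_space M \<longleftrightarrow>
     (\<exists>T. completely_metrizable_space T \<and> separable_space T \<and> topspace T = space M \<and>
          sets M = sigma_sets (space M) {U. openin T U})"

text \<open>System of constraints.  Variables are indexed by 'v, constraints by 'f.
  V(f) is given by Vf f; the bipartite graph B has an edge (v - f) iff v in Vf f.
  All variable spaces X_v are carried by one HOL type 'x with measurable
  structure N v; elements of X_S are extensional functions in space (PiM S N).
  The exogenous random variables X w live on the probability space P.\<close>
definition system_of_constraints ::
  "'w measure \<Rightarrow> ('v \<Rightarrow> 'x measure) \<Rightarrow> 'y measure \<Rightarrow> 'v set \<Rightarrow> 'f set \<Rightarrow> 'v set \<Rightarrow>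
   ('f \<Rightarrow> 'v set) \<Rightarrow> ('v \<Rightarrow> 'w \<Rightarrow> 'x) \<Rightarrow> ('f \<Rightarrow> ('v \<Rightarrow> 'x) \<Rightarrow> 'y) \<Rightarrow> ('f \<Rightarrow> 'y) \<Rightarrow> bool" where
  "system_of_constraints P N Y V F W Vf X phi c \<longleftrightarrow>
     finite V \<and> finite F \<and> W \<subseteq> V \<and> (\<forall>f\<in>F. Vf f \<subseteq> V) \<and>
     (\<forall>v\<in>V. standard_measurable_space (N v)) \<and> standard_measurable_space Y \<and>
     (\<forall>f\<in>F. c f \<in> space Y) \<and>
     (\<forall>f\<in>F. phi f \<in> PiM (Vf f) N \<rightarrow>\<^sub>M Y) \<and>
     prob_space P \<and> prob_space.indep_vars P N X W"

definition comb :: "'v set \<Rightarrow> ('v \<Rightarrow> 'w \<Rightarrow> 'x) \<Rightarrow> 'w \<Rightarrow> ('v \<Rightarrow> 'x) \<Rightarrow> 'v set \<Rightarrow> ('v \<Rightarrow> 'x)" where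
  "comb W X \<omega> x S = (\<lambda>v\<in>S. if v \<in> W then X v \<omega> else x v)"

definition Xstar :: "'v set \<Rightarrow> ('v \<Rightarrow> 'w \<Rightarrow> 'x) \<Rightarrow> (('v \<Rightarrow> 'x) \<Rightarrow> ('v \<Rightarrow> 'x)) \<Rightarrow> 'v \<Rightarrow> 'w \<Rightarrow> 'x" where
  "Xstar W X h v \<omega> = (if v \<in> W then X v \<omega> else h (\<lambda>w\<in>W. X w \<omega>) v)"

definition is_solution ::
  "'w measure \<Rightarrow> ('v \<Rightarrow> 'x measure) \<Rightarrow> 'v set \<Rightarrow> 'f set \<Rightarrow> 'v set \<Rightarrow>
   ('f \<Rightarrow> 'v set) \<Rightarrow> ('v \<Rightarrow> 'w \<Rightarrow> 'x) \<Rightarrow> ('f \<Rightarrow> ('v \<Rightarrow> 'x) \<Rightarrow> 'y) \<Rightarrow> ('f \<Rightarrow> 'y) \<Rightarrow>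
   (('v \<Rightarrow> 'x) \<Rightarrow> ('v \<Rightarrow> 'x)) \<Rightarrow> bool" where
  "is_solution P N V F W Vf X phi c h \<longleftrightarrow>
     h \<in> PiM W N \<rightarrow>\<^sub>M PiM (V - W) N \<and>
     (AE \<omega> in P. \<forall>f\<in>F. phi f (restrict (\<lambda>v. Xstar W X h v \<omega>) (Vf f)) = c f)"

definition solvable_wrt ::
  "'w measure \<Rightarrow> ('v \<Rightarrow> 'x measure) \<Rightarrow> 'v set \<Rightarrow> ('f \<Rightarrow> 'v set) \<Rightarrow> ('v \<Rightarrow> 'w \<Rightarrow> 'x) \<Rightarrow>
   ('f \<Rightarrow> ('v \<Rightarrow> 'x) \<Rightarrow> 'y) \<Rightarrow> ('f \<Rightarrow> 'y) \<Rightarrow> 'f set \<Rightarrow> 'v set \<Rightarrow> bool" where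
  "solvable_wrt P N W Vf X phi c SF SV \<longleftrightarrow>
     SV \<subseteq> (\<Union>f\<in>SF. Vf f) - W \<and>
     (\<exists>g \<in> PiM ((\<Union>f\<in>SF. Vf f) - SV) N \<rightarrow>\<^sub>M PiM SV N.
        AE \<omega> in P. \<forall>x \<in> space (PiM ((\<Union>f\<in>SF. Vf f) - W) N).
          restrict x SV = g (comb W X \<omega> x ((\<Union>f\<in>SF. Vf f) - SV)) \<longrightarrow>
          (\<forall>f\<in>SF. phi f (comb W X \<omega> x (Vf f)) = c f))"

definition uniquely_solvable_wrt ::
  "'w measure \<Rightarrow> ('v \<Rightarrow> 'x measure) \<Rightarrow> 'v set \<Rightarrow> ('f \<Rightarrow> 'v set) \<Rightarrow> ('v \<Rightarrow> 'w \<Rightarrow> 'x) \<Rightarrow>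
   ('f \<Rightarrow> ('v \<Rightarrow> 'x) \<Rightarrow> 'y) \<Rightarrow> ('f \<Rightarrow> 'y) \<Rightarrow> 'f set \<Rightarrow> 'v set \<Rightarrow> bool" where
  "uniquely_solvable_wrt P N W Vf X phi c SF SV \<longleftrightarrow>
     SV \<subseteq> (\<Union>f\<in>SF. Vf f) - W \<and>
     (\<exists>g \<in> PiM ((\<Union>f\<in>SF. Vf f) - SV) N \<rightarrow>\<^sub>M PiM SV N.
        AE \<omega> in P. \<forall>x \<in> space (PiM ((\<Union>f\<in>SF. Vf f) - W) N).
          restrict x SV = g (comb W X \<omega> x ((\<Union>f\<in>SF. Vf f) - SV)) \<longleftrightarrow>
          (\<forall>f\<in>SF. phi f (comb W X \<omega> x (Vf f)) = c f))"

text \<open>Vertices of B are of type 'v + 'f (Inl = variable, Inr = constraint);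
  subgraphs induced by a vertex set U.\<close>
definition bedge :: "('f \<Rightarrow> 'v set) \<Rightarrow> 'v + 'f \<Rightarrow> 'v + 'f \<Rightarrow> bool" where
  "bedge Vf x y \<longleftrightarrow> (\<exists>v f. (x = Inl v \<and> y = Inr f \<or> x = Inr f \<and> y = Inl v) \<and> v \<in> Vf f)"

definition adj :: "('f \<Rightarrow> 'v set) \<Rightarrow> ('v + 'f) set \<Rightarrow> ('v + 'f) set \<Rightarrow> ('v + 'f) set" where
  "adj Vf U S = {y \<in> U. \<exists>x\<in>S. bedge Vf x y}"

definition self_contained :: "('f \<Rightarrow> 'v set) \<Rightarrow> ('v + 'f) set \<Rightarrow> ('v + 'f) set \<Rightarrow> bool" where
  "self_contained Vf U S \<longleftrightarrow> S \<subseteq> U \<inter> range Inr \<and> finite S \<and>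
     card S = card (adj Vf U S) \<and> (\<forall>S'\<subseteq>S. card S' \<le> card (adj Vf U S'))"

definition min_self_contained :: "('f \<Rightarrow> 'v set) \<Rightarrow> ('v + 'f) set \<Rightarrow> ('v + 'f) set \<Rightarrow> bool" where
  "min_self_contained Vf U S \<longleftrightarrow> S \<noteq> {} \<and> self_contained Vf U S \<and>
     \<not> (\<exists>S'. S' \<noteq> {} \<and> S' \<subset> S \<and> self_contained Vf U S')"

definition matching :: "('f \<Rightarrow> 'v set) \<Rightarrow> ('v + 'f) set \<Rightarrow> ('v \<times> 'f) set \<Rightarrow> bool" where
  "matching Vf U M \<longleftrightarrow> M \<subseteq> {(v, f). Inl v \<in> U \<and> Inr f \<in> U \<and> v \<in> Vf f} \<and>
     (\<forall>(v, f)\<in>M. \<forall>(v', f')\<in>M. v = v' \<longleftrightarrow> f = f')"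

definition max_matching :: "('f \<Rightarrow> 'v set) \<Rightarrow> ('v + 'f) set \<Rightarrow> ('v \<times> 'f) set \<Rightarrow> bool" where
  "max_matching Vf U M \<longleftrightarrow> matching Vf U M \<and> finite M \<and>
     (\<forall>M'. matching Vf U M' \<and> finite M' \<longrightarrow> card M' \<le> card M)"

definition in_matching :: "('v \<times> 'f) set \<Rightarrow> 'v + 'f \<Rightarrow> 'v + 'f \<Rightarrow> bool" where
  "in_matching M x y \<longleftrightarrow> (\<exists>v f. (v, f) \<in> M \<and> (x = Inl v \<and> y = Inr f \<or> x = Inr f \<and> y = Inl v))"

definition matched :: "('v \<times> 'f) set \<Rightarrow> 'v + 'f \<Rightarrow> bool" where
  "matched M x \<longleftrightarrow> (\<exists>y. in_matching M x y)"

definition alt_path :: "('f \<Rightarrow> 'v set) \<Rightarrow> ('v + 'f) set \<Rightarrow> ('v \<times> 'f) set \<Rightarrow> ('v + 'f) list \<Rightarrow> bool" where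
  "alt_path Vf U M p \<longleftrightarrow> p \<noteq> [] \<and> distinct p \<and> set p \<subseteq> U \<and>
     (\<forall>i. Suc i < length p \<longrightarrow> bedge Vf (p ! i) (p ! Suc i) \<and>
          (in_matching M (p ! i) (p ! Suc i) \<longleftrightarrow> odd i))"

definition T_I :: "('f \<Rightarrow> 'v set) \<Rightarrow> ('v + 'f) set \<Rightarrow> ('v \<times> 'f) set \<Rightarrow> ('v + 'f) set" where
  "T_I Vf U M = {x. \<exists>p v. alt_path Vf U M p \<and> hd p = Inl v \<and> \<not> matched M (Inl v) \<and> last p = x}"

definition T_O :: "('f \<Rightarrow> 'v set) \<Rightarrow> ('v + 'f) set \<Rightarrow> ('v \<times> 'f) set \<Rightarrow> ('v + 'f) set" where
  "T_O Vf U M = {x. \<exists>p f. alt_path Vf U M p \<and> hd p = Inr f \<and> \<not> matched M (Inr f) \<and> last p = x}"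

definition T_C :: "('f \<Rightarrow> 'v set) \<Rightarrow> ('v + 'f) set \<Rightarrow> ('v \<times> 'f) set \<Rightarrow> ('v + 'f) set" where
  "T_C Vf U M = U - T_I Vf U M - T_O Vf U M"

definition components :: "('f \<Rightarrow> 'v set) \<Rightarrow> ('v + 'f) set \<Rightarrow> ('v + 'f) set set" where
  "components Vf U = {{y \<in> U. (x, y) \<in> {(a, b). a \<in> U \<and> b \<in> U \<and> bedge Vf a b}\<^sup>*} | x. x \<in> U}"

text \<open>Algorithm 1 (non-deterministic choice of minimal self-contained sets), as a relation:
  alg1 Vf B0 R Cl Ed means that running the loop from the current graph induced by R
  (inside the initial graph induced by B0) can produce clusters Cl and edges Ed.\<close>
inductive alg1 :: "('f \<Rightarrow> 'v set) \<Rightarrow> ('v + 'f) set \<Rightarrow> ('v + 'f) set \<Rightarrow>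
    ('v + 'f) set set \<Rightarrow> (('v + 'f) \<times> ('v + 'f) set) set \<Rightarrow> bool" for Vf B0 where
  alg1_stop: "alg1 Vf B0 {} {} {}"
| alg1_step: "R \<noteq> {} \<Longrightarrow> min_self_contained Vf R S \<Longrightarrow> C = S \<union> adj Vf R S \<Longrightarrow>
    alg1 Vf B0 (R - C) Cl Ed \<Longrightarrow>
    alg1 Vf B0 R (insert C Cl) (Ed \<union> {(x, C) | x. x \<in> adj Vf B0 S - adj Vf R S})"

definition clof :: "'a set set \<Rightarrow> 'a \<Rightarrow> 'a set" where
  "clof Cls x = (THE S. S \<in> Cls \<and> x \<in> S)"

text \<open>CO_graph Vf V F W M Cls Eds: (Cls, Eds) is a causal ordering graph produced by
  Algorithm 3, where M is the maximum matching of B' used for the coarse decomposition.\<close>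
definition CO_graph :: "('f \<Rightarrow> 'v set) \<Rightarrow> 'v set \<Rightarrow> 'f set \<Rightarrow> 'v set \<Rightarrow> ('v \<times> 'f) set \<Rightarrow>
    ('v + 'f) set set \<Rightarrow> (('v + 'f) \<times> ('v + 'f) set) set \<Rightarrow> bool" where
  "CO_graph Vf V F W M Cls Eds \<longleftrightarrow>
    (let U = Inl ` (V - W) \<union> Inr ` F; TI = T_I Vf U M; TO = T_O Vf U M; TC = T_C Vf U M in
     \<exists>ClC EdC. alg1 Vf TC TC ClC EdC \<and>
       Cls = ClC \<union> components Vf TI \<union> components Vf TO \<union> {{Inl w} | w. w \<in> W} \<and>
       Eds = EdC
         \<union> {(Inl v, clof Cls (Inr f)) | v f. v \<in> Vf f \<and>
               ((Inl v \<in> TO \<union> TC \<and> Inr f \<in> TI) \<or> (Inl v \<in> TO \<and> Inr f \<in> TC))}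
         \<union> {(Inl w, clof Cls (Inr f)) | w f. w \<in> W \<and> f \<in> F \<and> w \<in> Vf f})"

definition max_uniquely_solvable ::
  "'w measure \<Rightarrow> ('v \<Rightarrow> 'x measure) \<Rightarrow> 'v set \<Rightarrow> 'f set \<Rightarrow> 'v set \<Rightarrow>
   ('f \<Rightarrow> 'v set) \<Rightarrow> ('v \<Rightarrow> 'w \<Rightarrow> 'x) \<Rightarrow> ('f \<Rightarrow> ('v \<Rightarrow> 'x) \<Rightarrow> 'y) \<Rightarrow> ('f \<Rightarrow> 'y) \<Rightarrow>
   ('v \<times> 'f) set \<Rightarrow> ('v + 'f) set set \<Rightarrow> bool" where
  "max_uniquely_solvable P N V F W Vf X phi c M Cls \<longleftrightarrow>
    (let TI = T_I Vf (Inl ` (V - W) \<union> Inr ` F) M in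
     (\<forall>S\<in>Cls. S \<inter> Inl ` W = {} \<and> S \<inter> TI = {} \<longrightarrow>
        uniquely_solvable_wrt P N W Vf X phi c (Inr -` S) (Inl -` S)) \<and>
     solvable_wrt P N W Vf X phi c (Inr -` TI) (Inl -` TI - W))"

definition decluster :: "'a set set \<Rightarrow> ('a \<times> 'a set) set \<Rightarrow> ('a \<times> 'a) set" where
  "decluster Cls Eds = {(x, y). x \<in> \<Union>Cls \<and> y \<in> \<Union>Cls \<and> (x, clof Cls y) \<in> Eds}"

definition lp_dir :: "('a \<times> 'a) set \<Rightarrow> 'a set \<Rightarrow> 'a \<Rightarrow> 'a \<Rightarrow> bool" where
  "lp_dir E L x y \<longleftrightarrow> (\<exists>p. distinct p \<and> length p \<ge> 2 \<and> hd p = x \<and> last p = y \<and>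
      (\<forall>i. Suc i < length p \<longrightarrow> (p ! i, p ! Suc i) \<in> E) \<and>
      (\<forall>i. 0 < i \<and> Suc i < length p \<longrightarrow> p ! i \<in> L))"

definition lp_bi :: "('a \<times> 'a) set \<Rightarrow> 'a set \<Rightarrow> 'a \<Rightarrow> 'a \<Rightarrow> bool" where
  "lp_bi E L x y \<longleftrightarrow> (\<exists>p k. distinct p \<and> length p \<ge> 3 \<and> hd p = x \<and> last p = y \<and>
      0 < k \<and> Suc k < length p \<and>
      (\<forall>i. i < k \<longrightarrow> (p ! Suc i, p ! i) \<in> E) \<and>
      (\<forall>i. k \<le> i \<and> Suc i < length p \<longrightarrow> (p ! i, p ! Suc i) \<in> E) \<and>
      (\<forall>i. 0 < i \<and> Suc i < length p \<longrightarrow> p ! i \<in> L))"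

text \<open>Markov ordering graph MO(B) = D(CO(B)) with F marginalized out, as a directed mixed
  graph on the variables: (vertices, directed edges, bidirected edges).\<close>
definition MO_graph :: "('v + 'f) set set \<Rightarrow> (('v + 'f) \<times> ('v + 'f) set) set \<Rightarrow>
    'v set \<times> ('v \<times> 'v) set \<times> ('v \<times> 'v) set" where
  "MO_graph Cls Eds =
    ({v. Inl v \<in> \<Union>Cls},
     {(a, b). Inl a \<in> \<Union>Cls \<and> Inl b \<in> \<Union>Cls \<and> lp_dir (decluster Cls Eds) (range Inr) (Inl a) (Inl b)},
     {(a, b). Inl a \<in> \<Union>Cls \<and> Inl b \<in> \<Union>Cls \<and> lp_bi (decluster Cls Eds) (range Inr) (Inl a) (Inl b)})"

definition induced_dmg :: "'a set \<times> ('a \<times> 'a) set \<times> ('a \<times> 'a) set \<Rightarrow> 'a set \<Rightarrow>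
    'a set \<times> ('a \<times> 'a) set \<times> ('a \<times> 'a) set" where
  "induced_dmg G S = (case G of (Vs, D, B) \<Rightarrow> (Vs \<inter> S, D \<inter> (S \<times> S), B \<inter> (S \<times> S)))"

definition CO_vertices :: "('f \<Rightarrow> 'v set) \<Rightarrow> 'v set \<Rightarrow> 'f set \<Rightarrow> 'v set \<Rightarrow> ('v \<times> 'f) set \<Rightarrow> 'v set" where
  "CO_vertices Vf V F W M =
     (let U = Inl ` (V - W) \<union> Inr ` F in {v. Inl v \<in> T_C Vf U M \<union> T_O Vf U M} \<union> W)"

datatype edgemark = Fwd | Bwd | Bi

definition dmg_path :: "'a set \<times> ('a \<times> 'a) set \<times> ('a \<times> 'a) set \<Rightarrow> 'a list \<Rightarrow> edgemark list \<Rightarrow> bool" where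
  "dmg_path G p es \<longleftrightarrow> (case G of (Vs, D, B) \<Rightarrow>
     p \<noteq> [] \<and> distinct p \<and> set p \<subseteq> Vs \<and> length es = length p - 1 \<and>
     (\<forall>i < length es.
        (es ! i = Fwd \<longrightarrow> (p ! i, p ! Suc i) \<in> D) \<and>
        (es ! i = Bwd \<longrightarrow> (p ! Suc i, p ! i) \<in> D) \<and>
        (es ! i = Bi \<longrightarrow> (p ! i, p ! Suc i) \<in> B \<or> (p ! Suc i, p ! i) \<in> B)))"

definition collider :: "edgemark list \<Rightarrow> nat \<Rightarrow> bool" where
  "collider es i \<longleftrightarrow> 0 < i \<and> i < length es \<and> es ! (i - 1) \<in> {Fwd, Bi} \<and> es ! i \<in> {Bwd, Bi}"

definition ancestors :: "'a set \<times> ('a \<times> 'a) set \<times> ('a \<times> 'a) set \<Rightarrow> 'a set \<Rightarrow> 'a set" where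
  "ancestors G C = (case G of (Vs, D, B) \<Rightarrow>
     {a \<in> Vs. \<exists>c\<in>C. (a, c) \<in> (D \<inter> (Vs \<times> Vs))\<^sup>*})"

definition blocked :: "'a set \<times> ('a \<times> 'a) set \<times> ('a \<times> 'a) set \<Rightarrow> 'a set \<Rightarrow> 'a list \<Rightarrow> edgemark list \<Rightarrow> bool" where
  "blocked G C p es \<longleftrightarrow> (\<exists>i < length p.
      (collider es i \<and> p ! i \<notin> ancestors G C) \<or> (\<not> collider es i \<and> p ! i \<in> C))"

definition d_separated :: "'a set \<times> ('a \<times> 'a) set \<times> ('a \<times> 'a) set \<Rightarrow> 'a set \<Rightarrow> 'a set \<Rightarrow> 'a set \<Rightarrow> bool" where
  "d_separated G A B C \<longleftrightarrow>
     \<not> (\<exists>p es. dmg_path G p es \<and> hd p \<in> A \<and> last p \<in> B \<and> \<not> blocked G C p es)"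

definition joint_rv :: "('v \<Rightarrow> 'w \<Rightarrow> 'x) \<Rightarrow> 'v set \<Rightarrow> 'w \<Rightarrow> ('v \<Rightarrow> 'x)" where
  "joint_rv Z S \<omega> = (\<lambda>v\<in>S. Z v \<omega>)"

definition cond_indep :: "'w measure \<Rightarrow> ('v \<Rightarrow> 'x measure) \<Rightarrow> ('v \<Rightarrow> 'w \<Rightarrow> 'x) \<Rightarrow>
    'v set \<Rightarrow> 'v set \<Rightarrow> 'v set \<Rightarrow> bool" where
  "cond_indep P N Z A B C \<longleftrightarrow>
    (let G = vimage_algebra (space P) (joint_rv Z C) (PiM C N) in
     \<forall>SA \<in> sets (PiM A N). \<forall>SB \<in> sets (PiM B N).
       AE \<omega> in P.
         real_cond_exp P G (indicator (joint_rv Z A -` SA \<inter> joint_rv Z B -` SB \<inter> space P)) \<omega> =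
         real_cond_exp P G (indicator (joint_rv Z A -` SA \<inter> space P)) \<omega> *
         real_cond_exp P G (indicator (joint_rv Z B -` SB \<inter> space P)) \<omega>)"

end

theory Submission
  imports Defs
begin

text \<open>
  In the causal ordering graph no edge leaves a constraint vertex, so marginalizing the
  constraints just deletes them: the Markov ordering graph has no bidirected edges and, on
  \<open>T\<^sub>C\<close>, \<open>T\<^sub>O\<close> and the exogenous variables, it is a directed acyclic graph.  Unique solvability of
  a cluster makes each of its variables almost surely a function of its parents, so the
  solution is a deterministic structural model driven by the independent variables \<open>X\<^sub>w\<close>.

  For such a model the global Markov property is proved by induction on ancestral sets, looking
  at a sink \<open>v\<close>.  If \<open>v\<close> occurs in \<open>A\<close> or \<open>B\<close>, it is replaced by its parents, or split off by
  independence when it is exogenous.  If \<open>v\<close> occurs in \<open>C\<close>, it is a collider on every walk through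
  it, so \<open>A\<close> and \<open>B\<close> cannot both be connected to it given \<open>C - {v}\<close>; say \<open>A\<close> is not.  Then \<open>A\<close> is
  separated from \<open>B \<union> {v}\<close> given \<open>C - {v}\<close>, and weak union moves \<open>v\<close> into the conditioning set.
\<close>

section \<open>Open walks in directed graphs\<close>

text \<open>The graph argument uses walks because two walks ending at the sink get glued there,
  which destroys distinctness. Acyclicity repairs this once, when a shortest open walk becomes a
  path for the official d-separation. Walks live in the whole graph, also outside the current
  ancestral set, so separation keeps its meaning as the set shrinks; a sink is a sink only inside
  that set. It is a collider all the same: a walk leaving it along an arrow descends until it meets
  an open collider or ends in the set, and either way the sink would be a proper ancestor of a
  vertex of the set. Determination holds only almost surely, so sigma-algebras are compared up to
  null sets and no functions are composed along the graph. \<open>T_I\<close> is left out since its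
  variables are merely solvable, not determined by their parents. The rest does not look back at it:
  a \<open>T_C\<close> constraint never touches \<open>T_I\<close>, and a \<open>T_O\<close>
  constraint touches only \<open>T_O\<close> and exogenous variables. Acyclicity comes from the
  order exogenous, \<open>T_O\<close>, \<open>T_C\<close>, the last refined by the order in which
  the algorithm removes clusters.\<close>

definition adjacent :: "('a \<times> 'a) set \<Rightarrow> 'a \<Rightarrow> 'a \<Rightarrow> bool" where
  "adjacent D x y \<longleftrightarrow> (x, y) \<in> D \<or> (y, x) \<in> D"

definition anc :: "('a \<times> 'a) set \<Rightarrow> 'a set \<Rightarrow> 'a set" where
  "anc D C = {x. \<exists>c\<in>C. (x, c) \<in> D\<^sup>*}"

text \<open>The outer vertices may coincide: a walk may turn back at \<open>y\<close>, and then
  \<open>y\<close> counts as a collider exactly when the edge points into it.\<close>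

definition triple_open :: "('a \<times> 'a) set \<Rightarrow> 'a set \<Rightarrow> 'a \<Rightarrow> 'a \<Rightarrow> 'a \<Rightarrow> bool" where
  "triple_open D C x y z \<longleftrightarrow> (if (x, y) \<in> D \<and> (z, y) \<in> D then y \<in> anc D C else y \<notin> C)"

text \<open>End vertices are not tested; \<open>connected_given\<close> keeps them out of
  \<open>C\<close>. Hence two walks glue at a common end with a single new condition there
  (\<open>inner_open_append\<close>), and a piece may end in the conditioning set, as in
  \<open>connected_given_via_sink\<close>.\<close>

fun inner_open :: "('a \<times> 'a) set \<Rightarrow> 'a set \<Rightarrow> 'a list \<Rightarrow> bool" where
  "inner_open D C (x # y # z # zs) \<longleftrightarrow>
     adjacent D x y \<and> triple_open D C x y z \<and> inner_open D C (y # z # zs)"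
| "inner_open D C [x, y] \<longleftrightarrow> adjacent D x y"
| "inner_open D C _ \<longleftrightarrow> True"

definition connected_given :: "('a \<times> 'a) set \<Rightarrow> 'a set \<Rightarrow> 'a \<Rightarrow> 'a \<Rightarrow> bool" where
  "connected_given D C a b \<longleftrightarrow>
     a \<notin> C \<and> b \<notin> C \<and> (\<exists>w. w \<noteq> [] \<and> hd w = a \<and> last w = b \<and> inner_open D C w)"

lemma triple_open_commute: "triple_open D C x y z \<longleftrightarrow> triple_open D C z y x"
  by (auto simp: triple_open_def)

lemma anc_mono: "C \<subseteq> C' \<Longrightarrow> anc D C \<subseteq> anc D C'"
  by (auto simp: anc_def)

lemma anc_step: "(x, y) \<in> D \<Longrightarrow> y \<in> anc D C \<Longrightarrow> x \<in> anc D C"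
  by (auto simp: anc_def intro: converse_rtrancl_into_rtrancl)

lemma inner_open_append:
  "inner_open D C (us @ x # vs) \<longleftrightarrow>
     inner_open D C (us @ [x]) \<and> inner_open D C (x # vs) \<and>
     (us \<noteq> [] \<and> vs \<noteq> [] \<longrightarrow> triple_open D C (last us) x (hd vs))"
proof (induction us)
  case Nil
  then show ?case by simp
next
  case (Cons u us)
  show ?case
  proof (cases us)
    case Nil
    then show ?thesis by (cases vs) auto
  next
    case (Cons u' us')
    then show ?thesis using Cons.IH by (cases us') auto
  qed
qed

lemma inner_open_rev: "inner_open D C (rev w) \<longleftrightarrow> inner_open D C w"
proof (induction w)
  case Nil
  then show ?case by simp
next
  case (Cons x w)
  show ?case
  proof (cases w)
    case Nil
    then show ?thesis by simp
  next
    case (Cons y zs)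
    have "inner_open D C (rev (x # w)) \<longleftrightarrow> inner_open D C (rev zs @ y # [x])"
      by (simp add: Cons)
    also have "\<dots> \<longleftrightarrow> inner_open D C (rev w) \<and> adjacent D y x \<and>
        (zs \<noteq> [] \<longrightarrow> triple_open D C (hd zs) y x)"
      by (subst inner_open_append) (auto simp: Cons last_rev)
    also have "\<dots> \<longleftrightarrow> inner_open D C (x # w)"
      using Cons.IH Cons
      by (cases zs) (auto simp: triple_open_commute adjacent_def)
    finally show ?thesis .
  qed
qed

lemma inner_open_adjacent:
  "inner_open D C w \<Longrightarrow> Suc i < length w \<Longrightarrow> adjacent D (w ! i) (w ! Suc i)"
  by (induction D C w arbitrary: i rule: inner_open.induct)
    (auto simp: nth_Cons split: nat.splits)

lemma inner_open_triple:
  "inner_open D C w \<Longrightarrow> Suc (Suc i) < length w \<Longrightarrow>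
     triple_open D C (w ! i) (w ! Suc i) (w ! Suc (Suc i))"
  by (induction D C w arbitrary: i rule: inner_open.induct)
    (auto simp: nth_Cons split: nat.splits)

lemma connected_given_sym: "connected_given D C a b \<Longrightarrow> connected_given D C b a"
  unfolding connected_given_def
  by (metis hd_rev inner_open_rev last_rev rev_is_Nil_conv)

text \<open>A walk that leaves \<^term>\<open>x\<close> along an outgoing edge keeps following edge directions
  until it meets a collider or ends.\<close>
lemma inner_open_follow:
  "inner_open D C (x # y # zs) \<Longrightarrow> (x, y) \<in> D \<Longrightarrow>
     x \<in> anc D C \<or> (x, last (y # zs)) \<in> D\<^sup>+"
proof (induction zs arbitrary: x y)
  case Nil
  then show ?case by auto
next
  case (Cons z zs)
  show ?case
  proof (cases "(z, y) \<in> D")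
    case True
    then have "y \<in> anc D C" using Cons.prems by (auto simp: triple_open_def)
    then show ?thesis using Cons.prems anc_step by metis
  next
    case False
    then have "(y, z) \<in> D" using Cons.prems by (cases zs) (auto simp: adjacent_def)
    then have "y \<in> anc D C \<or> (y, last (z # zs)) \<in> D\<^sup>+"
      using Cons.IH[of y z] Cons.prems by auto
    then show ?thesis using Cons.prems anc_step by (metis last_ConsR list.discI trancl_into_trancl2)
  qed
qed

text \<open>Cutting the loop leaves one new triple at \<open>x\<close>. If it is a non-collider, so
  was one of the two old triples at \<open>x\<close>, hence \<open>x\<close> is not in
  \<open>C\<close>. If it is a collider, either the loop starts with an edge into \<open>x\<close>,
  so the first old triple was a collider as well, or it starts with an edge out of \<open>x\<close>;
  following that edge back to \<open>x\<close> gives an ancestor of \<open>C\<close> or a directed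
  cycle.\<close>

lemma inner_open_shortcut:
  assumes acyclic: "acyclic D" and io: "inner_open D C (us @ x # ms @ x # vs)"
  shows "inner_open D C (us @ x # vs)"
proof -
  have 1: "inner_open D C (us @ [x])" and 2: "inner_open D C (x # ms @ x # vs)"
    and 3: "us \<noteq> [] \<longrightarrow> triple_open D C (last us) x (hd (ms @ [x]))"
    using io by (auto simp: inner_open_append[of D C us x "ms @ x # vs"] hd_append)
  have 4: "inner_open D C (x # ms @ [x])" and 5: "inner_open D C (x # vs)"
    and 6: "vs \<noteq> [] \<longrightarrow> triple_open D C (last (x # ms)) x (hd vs)"
    using 2 inner_open_append[of D C "x # ms" x vs] by auto
  have nl: "(x, x) \<notin> D" using acyclic by (auto simp: acyclic_def)
  have ms: "ms \<noteq> []" using 4 nl by (auto simp: adjacent_def)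
  then obtain m ms' where m: "ms = m # ms'" by (cases ms) auto
  have "triple_open D C (last us) x (hd vs)" if "us \<noteq> []" "vs \<noteq> []"
  proof (cases "(last us, x) \<in> D \<and> (hd vs, x) \<in> D")
    case True
    have "x \<in> anc D C"
    proof (cases "(m, x) \<in> D")
      case True
      then show ?thesis using 3 that \<open>_ \<and> _\<close> m by (auto simp: triple_open_def)
    next
      case False
      moreover have "adjacent D x m" using inner_open_adjacent[OF 4, of 0] m by simp
      ultimately have "(x, m) \<in> D" by (auto simp: adjacent_def)
      then have "x \<in> anc D C \<or> (x, x) \<in> D\<^sup>+"
        using inner_open_follow[of D C x m "ms' @ [x]"] 4 m by simp
      then show ?thesis using acyclic by (auto simp: acyclic_def)
    qed
    then show ?thesis using True by (auto simp: triple_open_def)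
  next
    case False
    then show ?thesis using 3 6 that by (auto simp: triple_open_def split: if_splits)
  qed
  then show ?thesis using 1 5 by (subst inner_open_append) auto
qed

text \<open>A shortest open walk repeats no vertex, since the loop could be cut out.\<close>

lemma connected_given_distinct:
  assumes "acyclic D" and "connected_given D C a b"
  obtains w where "w \<noteq> []" "hd w = a" "last w = b" "inner_open D C w" "distinct w"
proof -
  define Q where "Q w \<longleftrightarrow> w \<noteq> [] \<and> hd w = a \<and> last w = b \<and> inner_open D C w" for w
  have "\<exists>w. Q w" using assms(2) by (auto simp: connected_given_def Q_def)
  then obtain w where w: "Q w" and min: "\<And>w'. Q w' \<Longrightarrow> length w \<le> length w'"
    using ex_has_least_nat[of Q _ length] by blast
  have "distinct w"
  proof (rule ccontr)
    assume "\<not> distinct w"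
    then obtain us ms vs x where d: "w = us @ [x] @ ms @ [x] @ vs"
      using not_distinct_decomp by blast
    have "Q (us @ x # vs)"
      using w d inner_open_shortcut[OF assms(1), of C us x ms vs]
      by (auto simp: Q_def hd_append split: if_splits)
    from min[OF this] show False using d by simp
  qed
  then show ?thesis using that w by (auto simp: Q_def)
qed

text \<open>Link to the official notion, which uses paths with edge marks. An acyclic graph has no
  pair of opposite edges, so the marks along the path are forced and the colliders they define are
  those of \<open>triple_open\<close>.\<close>

lemma connected_given_imp_not_d_separated:
  assumes ac: "acyclic D" and D: "D \<subseteq> Vs \<times> Vs"
    and con: "connected_given D C a b" and ab: "a \<in> A" "b \<in> B" "a \<in> Vs" and C: "C \<subseteq> Vs"
  shows "\<not> d_separated (Vs, D, {}) A B C"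
proof -
  obtain p where p: "p \<noteq> []" "hd p = a" "last p = b" "inner_open D C p" "distinct p"
    using connected_given_distinct[OF ac con] by metis
  define es where "es = map (\<lambda>i. if (p ! i, p ! Suc i) \<in> D then Fwd else Bwd) [0..<length p - 1]"
  have les: "length es = length p - 1" by (simp add: es_def)
  have nth_es: "es ! i = (if (p ! i, p ! Suc i) \<in> D then Fwd else Bwd)" if "i < length p - 1" for i
    using that by (simp add: es_def)
  have adjp: "adjacent D (p ! i) (p ! Suc i)" if "i < length p - 1" for i
    using inner_open_adjacent[OF p(4), of i] that by simp
  have anti: "(x, y) \<in> D \<Longrightarrow> (y, x) \<notin> D" for x y
    using ac unfolding acyclic_def by (meson r_into_trancl trancl_into_trancl)
  have "p ! i \<in> Vs" if "i < length p" for i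
  proof (cases i)
    case 0
    then show ?thesis using p ab by (simp add: hd_conv_nth)
  next
    case (Suc j)
    then have "j < length p - 1" using that by simp
    then show ?thesis using adjp[of j] Suc D by (auto simp: adjacent_def)
  qed
  then have "set p \<subseteq> Vs" by (auto simp: in_set_conv_nth)
  then have path: "dmg_path (Vs, D, {}) p es"
    using p les nth_es adjp by (auto simp: dmg_path_def adjacent_def)
  have col: "collider es (Suc j) \<longleftrightarrow> (p ! j, p ! Suc j) \<in> D \<and> (p ! Suc (Suc j), p ! Suc j) \<in> D"
    if "Suc (Suc j) < length p" for j
  proof -
    have j1: "j < length p - 1" and j2: "Suc j < length p - 1" using that by auto
    have "collider es (Suc j) \<longleftrightarrow> (p ! j, p ! Suc j) \<in> D \<and> (p ! Suc j, p ! Suc (Suc j)) \<notin> D"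
      using nth_es[OF j1] nth_es[OF j2] j2 les by (simp add: collider_def)
    then show ?thesis using adjp[OF j2] anti by (auto simp: adjacent_def)
  qed
  have nb: "\<not> blocked (Vs, D, {}) C p es"
  proof
    assume "blocked (Vs, D, {}) C p es"
    then obtain i where i: "i < length p"
      and b: "(collider es i \<and> p ! i \<notin> ancestors (Vs, D, {}) C) \<or> (\<not> collider es i \<and> p ! i \<in> C)"
      by (auto simp: blocked_def)
    have "p ! 0 \<notin> C" "p ! (length p - 1) \<notin> C"
      using p con by (auto simp: connected_given_def hd_conv_nth last_conv_nth)
    moreover have "\<not> collider es 0" "\<not> collider es (length p - 1)"
      using les by (auto simp: collider_def)
    ultimately have "i \<noteq> 0" "i \<noteq> length p - 1" using b by metis+
    then obtain j where j: "i = Suc j" "Suc (Suc j) < length p" using i by (cases i) auto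
    have "D \<inter> Vs \<times> Vs = D" using D by auto
    then have "p ! i \<in> anc D C \<longrightarrow> p ! i \<in> ancestors (Vs, D, {}) C"
      using \<open>\<And>i. i < length p \<Longrightarrow> p ! i \<in> Vs\<close>[OF i] by (auto simp: anc_def ancestors_def)
    then show False
      using b col[OF j(2)] inner_open_triple[OF p(4) j(2)] j(1)
      by (auto simp: triple_open_def split: if_splits)
  qed
  show ?thesis using path nb p ab by (auto simp: d_separated_def)
qed

section \<open>Conditional independence of families of random variables\<close>

text \<open>The sigma-algebra generated by the subfamily on \<open>S\<close>, kept as a plain set
  system with single-coordinate generators. It is then monotone in \<open>S\<close>, and claims
  about it reduce to one variable at a time.\<close>

definition gen_events :: "'w measure \<Rightarrow> ('v \<Rightarrow> 'x measure) \<Rightarrow> ('v \<Rightarrow> 'w \<Rightarrow> 'x) \<Rightarrow> 'v set \<Rightarrow> 'w set set" where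
  "gen_events P N Z S = sigma_sets (space P) (\<Union>v\<in>S. {Z v -` T \<inter> space P |T. T \<in> sets (N v)})"

text \<open>The variable \<open>u\<close> is a conditional probability of \<open>a\<close> given the family \<open>C\<close>, required to serve
  also as one given \<open>B \<union> C\<close>; in this form weak union is immediate and symmetry needs a proof.\<close>
definition indep_given :: "'w measure \<Rightarrow> ('v \<Rightarrow> 'x measure) \<Rightarrow> ('v \<Rightarrow> 'w \<Rightarrow> 'x) \<Rightarrow> 'v set \<Rightarrow> 'v set \<Rightarrow> 'v set \<Rightarrow> bool" where
  "indep_given P N Z A B C \<longleftrightarrow> (\<forall>a\<in>gen_events P N Z A. \<exists>u :: 'w \<Rightarrow> real \<in> borel_measurable (sigma (space P) (gen_events P N Z C)).
     integrable P u \<and> (\<forall>E\<in>gen_events P N Z (B \<union> C). (LINT \<omega>:E|P. indicator a \<omega>) = (LINT \<omega>:E|P. u \<omega>)))"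

text \<open>Functional dependence expressed through events: the family on \<open>S\<close> is almost
  surely determined by the family on \<open>T\<close>. This is transitive without any choice of
  measurable functions.\<close>

definition ae_subsumed :: "'w measure \<Rightarrow> ('v \<Rightarrow> 'x measure) \<Rightarrow> ('v \<Rightarrow> 'w \<Rightarrow> 'x) \<Rightarrow> 'v set \<Rightarrow> 'v set \<Rightarrow> bool" where
  "ae_subsumed P N Z S T \<longleftrightarrow> (\<forall>a\<in>gen_events P N Z S. \<exists>b\<in>gen_events P N Z T. AE \<omega> in P. \<omega> \<in> a \<longleftrightarrow> \<omega> \<in> b)"

text \<open>Dynkin argument: the sets over which two integrals agree are closed under complement, as
  \<open>space P\<close> is one of them, and under countable disjoint unions.\<close>

lemma set_lebesgue_integral_eq_on_sigma_sets:
  fixes f g :: "'w \<Rightarrow> real"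
  assumes E: "Int_stable E" "E \<subseteq> sets P" "space P \<in> E"
    and fg: "integrable P f" "integrable P g"
    and eq: "\<And>e. e \<in> E \<Longrightarrow> (LINT \<omega>:e|P. f \<omega>) = (LINT \<omega>:e|P. g \<omega>)"
    and e: "e \<in> sigma_sets (space P) E"
  shows "(LINT \<omega>:e|P. f \<omega>) = (LINT \<omega>:e|P. g \<omega>)"
proof -
  have sub: "E \<subseteq> Pow (space P)" using E(2) sets.sets_into_space by blast
  have meas: "A \<in> sets P" if "A \<in> sigma_sets (space P) E" for A
    using that E(2) sets.sigma_sets_subset by blast
  have si: "set_integrable P A f" "set_integrable P A g" if "A \<in> sets P" for A
    using that fg unfolding set_integrable_def by (blast intro: integrable_mult_indicator)+
  show ?thesis
    using E(1) sub e
  proof (induction rule: sigma_sets_induct_disjoint)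
    case (basic A)
    then show ?case by (rule eq)
  next
    case empty
    then show ?case by (simp add: set_lebesgue_integral_def)
  next
    case (compl A)
    have A: "A \<in> sets P" using compl meas by blast
    have *: "(LINT \<omega>:space P - A|P. k \<omega>) = (LINT \<omega>:space P|P. k \<omega>) - (LINT \<omega>:A|P. k \<omega>)"
      if "integrable P k" for k :: "'w \<Rightarrow> real"
    proof -
      have s: "set_integrable P B k" if "B \<in> sets P" for B
        using that \<open>integrable P k\<close> unfolding set_integrable_def by (rule integrable_mult_indicator)
      have "(LINT \<omega>:(space P - A) \<union> A|P. k \<omega>) = (LINT \<omega>:space P - A|P. k \<omega>) + (LINT \<omega>:A|P. k \<omega>)"
        using A s by (intro set_integral_Un) auto
      moreover have "(space P - A) \<union> A = space P" using A sets.sets_into_space by blast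
      ultimately show ?thesis by simp
    qed
    show ?case using *[OF fg(1)] *[OF fg(2)] compl eq[OF E(3)] by simp
  next
    case (union A)
    have A: "A i \<in> sets P" for i using union meas by blast
    have *: "(LINT \<omega>:(\<Union>i. A i)|P. k \<omega>) = (\<Sum>i. (LINT \<omega>:A i|P. k \<omega>))"
      if "integrable P k" for k :: "'w \<Rightarrow> real"
    proof (rule lebesgue_integral_countable_add)
      show "A i \<inter> A j = {}" if "i \<noteq> j" for i j
        using union(1) that by (auto simp: disjoint_family_on_def)
      show "set_integrable P (\<Union>i. A i) k"
        using A \<open>integrable P k\<close> unfolding set_integrable_def by (intro integrable_mult_indicator) auto
    qed (use A in auto)
    show ?case using *[OF fg(1)] *[OF fg(2)] union by simp
  qed
qed

lemma sigma_algebra_gen_events: "sigma_algebra (space P) (gen_events P N Z S)"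
  unfolding gen_events_def by (rule sigma_algebra_sigma_sets) auto

lemma gen_events_mono: "S \<subseteq> T \<Longrightarrow> gen_events P N Z S \<subseteq> gen_events P N Z T"
  unfolding gen_events_def by (rule sigma_sets_subseteq) auto

lemma space_in_gen_events: "space P \<in> gen_events P N Z S"
  unfolding gen_events_def by (rule sigma_sets_top)

lemma gen_events_Int: "a \<in> gen_events P N Z S \<Longrightarrow> b \<in> gen_events P N Z S \<Longrightarrow> a \<inter> b \<in> gen_events P N Z S"
proof -
  interpret sigma_algebra "space P" "gen_events P N Z S" by (rule sigma_algebra_gen_events)
  show "a \<in> gen_events P N Z S \<Longrightarrow> b \<in> gen_events P N Z S \<Longrightarrow> a \<inter> b \<in> gen_events P N Z S" by (rule Int)
qed

lemma gen_events_into_space: "a \<in> gen_events P N Z S \<Longrightarrow> a \<subseteq> space P"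
  unfolding gen_events_def by (rule sigma_sets_into_sp) auto

lemma sets_sigma_gen_events [simp]: "sets (sigma (space P) (gen_events P N Z S)) = gen_events P N Z S"
  using sigma_algebra.sets_measure_of_eq[OF sigma_algebra_gen_events] .

lemma vimage_in_gen_events: "v \<in> R \<Longrightarrow> A \<in> sets (N v) \<Longrightarrow> Z v -` A \<inter> space P \<in> gen_events P N Z R"
  unfolding gen_events_def by (intro sigma_sets.Basic) blast

text \<open>Intersections of one event from each side generate the join and are stable under
  intersection, which is what the Dynkin argument for integrals asks for.\<close>

lemma gen_events_Un:
  "gen_events P N Z (S \<union> T) = sigma_sets (space P) {a \<inter> b |a b. a \<in> gen_events P N Z S \<and> b \<in> gen_events P N Z T}"
    (is "_ = sigma_sets _ ?E")
proof
  have "x \<in> ?E" if "x \<in> gen_events P N Z S \<or> x \<in> gen_events P N Z T" for x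
    using that
  proof
    assume x: "x \<in> gen_events P N Z S"
    then have "x = x \<inter> space P" using gen_events_into_space[OF x] by auto
    then show ?thesis using x space_in_gen_events[of P N Z T] by blast
  next
    assume x: "x \<in> gen_events P N Z T"
    then have "x = space P \<inter> x" using gen_events_into_space[OF x] by auto
    then show ?thesis using x space_in_gen_events[of P N Z S] by blast
  qed
  note in_E = this
  show "gen_events P N Z (S \<union> T) \<subseteq> sigma_sets (space P) ?E"
    unfolding gen_events_def[of P N Z "S \<union> T"]
  proof (rule sigma_sets_mono, rule subsetI)
    fix a assume "a \<in> (\<Union>v\<in>S \<union> T. {Z v -` A \<inter> space P |A. A \<in> sets (N v)})"
    then obtain v A where a: "a = Z v -` A \<inter> space P" "v \<in> S \<or> v \<in> T" "A \<in> sets (N v)" by auto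
    then show "a \<in> sigma_sets (space P) ?E"
      using vimage_in_gen_events[of v S A N Z P] vimage_in_gen_events[of v T A N Z P]
      by (intro sigma_sets.Basic in_E) auto
  qed
  have "?E \<subseteq> gen_events P N Z (S \<union> T)"
    using gen_events_mono[of S "S \<union> T" P N Z] gen_events_mono[of T "S \<union> T" P N Z]
    by (auto intro!: gen_events_Int)
  then show "sigma_sets (space P) ?E \<subseteq> gen_events P N Z (S \<union> T)"
    by (rule sigma_algebra.sigma_sets_subset[OF sigma_algebra_gen_events])
qed

lemma Int_stable_gen_events_Int: "Int_stable {a \<inter> b |a b. a \<in> gen_events P N Z S \<and> b \<in> gen_events P N Z T}"
proof (rule Int_stableI)
  fix x y assume "x \<in> {a \<inter> b |a b. a \<in> gen_events P N Z S \<and> b \<in> gen_events P N Z T}"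
    "y \<in> {a \<inter> b |a b. a \<in> gen_events P N Z S \<and> b \<in> gen_events P N Z T}"
  then obtain a b a' b' where "x = a \<inter> b" "y = a' \<inter> b'" "a \<in> gen_events P N Z S" "b \<in> gen_events P N Z T"
    "a' \<in> gen_events P N Z S" "b' \<in> gen_events P N Z T" by blast
  then show "x \<inter> y \<in> {a \<inter> b |a b. a \<in> gen_events P N Z S \<and> b \<in> gen_events P N Z T}"
    by (intro CollectI exI[of _ "a \<inter> a'"] exI[of _ "b \<inter> b'"]) (auto intro: gen_events_Int)
qed

lemma ae_subsumed_refl: "S \<subseteq> T \<Longrightarrow> ae_subsumed P N Z S T"
  unfolding ae_subsumed_def using gen_events_mono by fastforce

lemma ae_subsumed_trans: "ae_subsumed P N Z S T \<Longrightarrow> ae_subsumed P N Z T U \<Longrightarrow> ae_subsumed P N Z S U"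
  unfolding ae_subsumed_def
proof
  fix a assume S: "\<forall>a\<in>gen_events P N Z S. \<exists>b\<in>gen_events P N Z T. AE \<omega> in P. \<omega> \<in> a \<longleftrightarrow> \<omega> \<in> b"
    and T: "\<forall>a\<in>gen_events P N Z T. \<exists>b\<in>gen_events P N Z U. AE \<omega> in P. \<omega> \<in> a \<longleftrightarrow> \<omega> \<in> b"
    and a: "a \<in> gen_events P N Z S"
  obtain b where b: "b \<in> gen_events P N Z T" "AE \<omega> in P. \<omega> \<in> a \<longleftrightarrow> \<omega> \<in> b" using S a by blast
  obtain d where d: "d \<in> gen_events P N Z U" "AE \<omega> in P. \<omega> \<in> b \<longleftrightarrow> \<omega> \<in> d" using T b by blast
  have "AE \<omega> in P. \<omega> \<in> a \<longleftrightarrow> \<omega> \<in> d" using b(2) d(2) by eventually_elim simp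
  then show "\<exists>b\<in>gen_events P N Z U. AE \<omega> in P. \<omega> \<in> a \<longleftrightarrow> \<omega> \<in> b" using d by blast
qed

text \<open>Events that agree almost surely with some event of the target form a sigma-algebra, so
  generators suffice.\<close>

lemma gen_events_leI:
  assumes "\<And>v T. v \<in> S \<Longrightarrow> T \<in> sets (N v) \<Longrightarrow>
    \<exists>b\<in>gen_events P N Z R. AE \<omega> in P. \<omega> \<in> Z v -` T \<inter> space P \<longleftrightarrow> \<omega> \<in> b"
  shows "ae_subsumed P N Z S R"
  unfolding ae_subsumed_def
proof
  interpret R: sigma_algebra "space P" "gen_events P N Z R" by (rule sigma_algebra_gen_events)
  fix a assume "a \<in> gen_events P N Z S"
  then show "\<exists>b\<in>gen_events P N Z R. AE \<omega> in P. \<omega> \<in> a \<longleftrightarrow> \<omega> \<in> b"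
    unfolding gen_events_def[of P N Z S]
  proof (induction rule: sigma_sets.induct)
    case (Basic a)
    then show ?case using assms by blast
  next
    case Empty
    then show ?case by (intro bexI[of _ "{}"]) auto
  next
    case (Compl a)
    then obtain b where b: "b \<in> gen_events P N Z R" "AE \<omega> in P. \<omega> \<in> a \<longleftrightarrow> \<omega> \<in> b" by blast
    from b(2) have "AE \<omega> in P. \<omega> \<in> space P - a \<longleftrightarrow> \<omega> \<in> space P - b" by eventually_elim simp
    then show ?case using b(1) by blast
  next
    case (Union a)
    then have "\<forall>i. \<exists>b\<in>gen_events P N Z R. AE \<omega> in P. \<omega> \<in> a i \<longleftrightarrow> \<omega> \<in> b" by blast
    then obtain b where b: "\<And>i. b i \<in> gen_events P N Z R" "\<And>i. AE \<omega> in P. \<omega> \<in> a i \<longleftrightarrow> \<omega> \<in> b i"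
      by metis
    have "AE \<omega> in P. \<forall>i::nat. \<omega> \<in> a i \<longleftrightarrow> \<omega> \<in> b i" using b(2) by (simp add: AE_all_countable)
    then have "AE \<omega> in P. \<omega> \<in> (\<Union>i. a i) \<longleftrightarrow> \<omega> \<in> (\<Union>i. b i)" by eventually_elim simp
    moreover have "(\<Union>i. b i) \<in> gen_events P N Z R" using b(1) by blast
    ultimately show ?case by blast
  qed
qed

lemma ae_subsumed_Un:
  assumes "ae_subsumed P N Z S U" "ae_subsumed P N Z T U"
  shows "ae_subsumed P N Z (S \<union> T) U"
proof (rule gen_events_leI)
  fix v A assume v: "v \<in> S \<union> T" and A: "A \<in> sets (N v)"
  have "Z v -` A \<inter> space P \<in> gen_events P N Z R" if "v \<in> R" for R
    unfolding gen_events_def using that A by (intro sigma_sets.Basic) blast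
  then show "\<exists>b\<in>gen_events P N Z U. AE \<omega> in P. \<omega> \<in> Z v -` A \<inter> space P \<longleftrightarrow> \<omega> \<in> b"
    using v assms by (auto simp only: ae_subsumed_def Un_iff)
qed

text \<open>The same \<open>u\<close> is a witness: it is measurable for the larger conditioning
  family, and the events on which it is tested do not change.\<close>

lemma indep_given_weak_union: "indep_given P N Z A (B \<union> D) C \<Longrightarrow> indep_given P N Z A B (C \<union> D)"
proof -
  assume *: "indep_given P N Z A (B \<union> D) C"
  have "borel_measurable (sigma (space P) (gen_events P N Z C))
      \<subseteq> (borel_measurable (sigma (space P) (gen_events P N Z (C \<union> D))) :: ('a \<Rightarrow> real) set)"
    by (intro measurable_mono) (auto simp: space_measure_of_conv intro: gen_events_mono[THEN subsetD])
  then show ?thesis using * unfolding indep_given_def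
    by (simp add: Un_ac) blast
qed

text \<open>The bound \<open>B \<union> C\<close> on \<open>B'\<close> lets conditioning variables
  join the right side for free; \<open>ci_Diff_imp\<close> is built on this.\<close>

lemma indep_given_mono:
  assumes "indep_given P N Z A B C" "A' \<subseteq> A" "B' \<subseteq> B \<union> C"
  shows "indep_given P N Z A' B' C"
proof -
  have "gen_events P N Z A' \<subseteq> gen_events P N Z A" "gen_events P N Z (B' \<union> C) \<subseteq> gen_events P N Z (B \<union> C)"
    using assms(2,3) by (intro gen_events_mono; auto)+
  then show ?thesis using assms(1) unfolding indep_given_def by (meson subsetD)
qed

section \<open>Conditional independence versus the product formula for conditional expectations;
  symmetry\<close>

locale random_family = prob_space P for P :: "'w measure" +
  fixes N :: "'v \<Rightarrow> 'x measure" and Z :: "'v \<Rightarrow> 'w \<Rightarrow> 'x" and I :: "'v set"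
  assumes measurable_Z: "v \<in> I \<Longrightarrow> Z v \<in> P \<rightarrow>\<^sub>M N v"
begin

abbreviation \<sigma> where "\<sigma> \<equiv> gen_events P N Z"
abbreviation ci where "ci \<equiv> indep_given P N Z"
abbreviation le where "le \<equiv> ae_subsumed P N Z"

lemma integrable_indicat: "a \<in> sets P \<Longrightarrow> integrable P (indicat_real a)"
  by (simp add: less_top[symmetric])

lemma gen_events_subset_sets: "S \<subseteq> I \<Longrightarrow> \<sigma> S \<subseteq> sets P"
  unfolding gen_events_def using measurable_Z by (intro sets.sigma_sets_subset) (auto intro: measurable_sets)

text \<open>Bridge to \<open>cond_indep\<close>, whose conditioning sigma-algebra is pulled back
  along \<open>joint_rv\<close>; it holds because the product sigma-algebra is generated by the
  coordinates.\<close>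

lemma sets_vimage_algebra_joint_rv:
  "sets (vimage_algebra (space P) (joint_rv Z S) (PiM S N)) = \<sigma> S" if S: "S \<subseteq> I"
proof
  have Zs: "Z v \<omega> \<in> space (N v)" if "v \<in> S" "\<omega> \<in> space P" for v \<omega>
    using measurable_space[OF measurable_Z[of v]] S that by auto
  have "joint_rv Z S \<in> sigma (space P) (\<sigma> S) \<rightarrow>\<^sub>M PiM S N"
    unfolding joint_rv_def
  proof (rule measurable_restrict)
    fix v assume v: "v \<in> S"
    show "Z v \<in> sigma (space P) (\<sigma> S) \<rightarrow>\<^sub>M N v"
    proof (rule measurableI)
      fix T assume "T \<in> sets (N v)"
      then have "Z v -` T \<inter> space P \<in> \<sigma> S"
        unfolding gen_events_def using v by (intro sigma_sets.Basic) blast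
      then show "Z v -` T \<inter> space (sigma (space P) (\<sigma> S)) \<in> sets (sigma (space P) (\<sigma> S))"
        by (simp add: space_measure_of_conv)
    qed (use Zs v in \<open>simp add: space_measure_of_conv\<close>)
  qed
  then have "joint_rv Z S -` T \<inter> space P \<in> \<sigma> S" if "T \<in> sets (PiM S N)" for T
    using measurable_sets[OF _ that, of "joint_rv Z S" "sigma (space P) (\<sigma> S)"] by (simp add: space_measure_of_conv)
  moreover have js: "joint_rv Z S \<in> space P \<rightarrow> space (PiM S N)"
    using Zs by (auto simp: joint_rv_def space_PiM)
  ultimately show "sets (vimage_algebra (space P) (joint_rv Z S) (PiM S N)) \<subseteq> \<sigma> S"
    by (auto simp: sets_vimage_algebra2)
  have "Z v -` T \<inter> space P \<in> sets (vimage_algebra (space P) (joint_rv Z S) (PiM S N))"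
    if "v \<in> S" "T \<in> sets (N v)" for v T
  proof -
    have "(\<lambda>x. x v) -` T \<inter> space (PiM S N) \<in> sets (PiM S N)"
      using that by (intro measurable_sets[OF measurable_component_singleton]) auto
    then have "joint_rv Z S -` ((\<lambda>x. x v) -` T \<inter> space (PiM S N)) \<inter> space P
        \<in> sets (vimage_algebra (space P) (joint_rv Z S) (PiM S N))"
      by (rule in_vimage_algebra)
    moreover have "joint_rv Z S -` ((\<lambda>x. x v) -` T \<inter> space (PiM S N)) \<inter> space P = Z v -` T \<inter> space P"
      using js that by (auto simp: joint_rv_def)
    ultimately show ?thesis by simp
  qed
  then have "(\<Union>v\<in>S. {Z v -` T \<inter> space P |T. T \<in> sets (N v)})
      \<subseteq> sets (vimage_algebra (space P) (joint_rv Z S) (PiM S N))"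
    by auto
  from sets.sigma_sets_subset[OF this]
  show "\<sigma> S \<subseteq> sets (vimage_algebra (space P) (joint_rv Z S) (PiM S N))"
    by (simp add: gen_events_def)
qed

text \<open>An event of \<open>A'\<close> differs from one of \<open>A\<close> by a null set, so the
  integrals agree and the witness \<open>u\<close> of the latter can be kept.\<close>

lemma ci_functional_left:
  assumes "ci A B C" and "le A' A" and A: "A \<subseteq> I" "A' \<subseteq> I" "B \<subseteq> I" "C \<subseteq> I"
  shows "ci A' B C"
  unfolding indep_given_def
proof
  fix a' assume "a' \<in> \<sigma> A'"
  then obtain a where a: "a \<in> \<sigma> A" "AE \<omega> in P. \<omega> \<in> a' \<longleftrightarrow> \<omega> \<in> a"
    using assms(2) by (auto simp: ae_subsumed_def)
  obtain u where u: "u \<in> borel_measurable (sigma (space P) (\<sigma> C))" "integrable P u"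
    "\<And>E. E \<in> \<sigma> (B \<union> C) \<Longrightarrow> (LINT \<omega>:E|P. indicat_real a \<omega>) = (LINT \<omega>:E|P. u \<omega>)"
    using assms(1) a(1) unfolding indep_given_def by blast
  have "(LINT \<omega>:E|P. indicat_real a' \<omega>) = (LINT \<omega>:E|P. indicator a \<omega>)"
    if "E \<in> \<sigma> (B \<union> C)" for E
    unfolding set_lebesgue_integral_def
  proof (rule integral_cong_AE)
    have m: "E \<in> sets P" "a' \<in> sets P" "a \<in> sets P"
      using that \<open>a' \<in> \<sigma> A'\<close> a(1) A gen_events_subset_sets[of "B \<union> C"] gen_events_subset_sets[of A] gen_events_subset_sets[of A'] by blast+
    then show "(\<lambda>\<omega>. indicat_real E \<omega> *\<^sub>R indicat_real a' \<omega>) \<in> borel_measurable P"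
      "(\<lambda>\<omega>. indicat_real E \<omega> *\<^sub>R indicat_real a \<omega>) \<in> borel_measurable P" by auto
    show "AE \<omega> in P. indicat_real E \<omega> *\<^sub>R indicat_real a' \<omega> = indicat_real E \<omega> *\<^sub>R indicat_real a \<omega>"
      using a(2) by eventually_elim (simp add: indicator_def)
  qed
  then show "\<exists>u :: 'w \<Rightarrow> real \<in> borel_measurable (sigma (space P) (\<sigma> C)).
      integrable P u \<and> (\<forall>E\<in>\<sigma> (B \<union> C). (LINT \<omega>:E|P. indicator a' \<omega>) = (LINT \<omega>:E|P. u \<omega>))"
    using u by auto
qed

lemma subalgebraI:
  assumes "C \<subseteq> I" "space F = space P" "sets F = \<sigma> C"
  shows "finite_measure_subalgebra P F"
  using assms gen_events_subset_sets by unfold_locales (auto simp: subalgebra_def)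

lemma measurable_gen_events_cong:
  assumes "space F = space P" "sets F = \<sigma> C"
  shows "borel_measurable (sigma (space P) (\<sigma> C)) = (borel_measurable F :: ('w \<Rightarrow> real) set)"
  using assms by (intro measurable_cong_sets) auto

text \<open>The witness \<open>u\<close> is a version of the conditional probability of
  \<open>a\<close>. Integrated over \<open>g\<close> in \<open>F\<close>, the event
  \<open>a \<inter> b\<close> becomes \<open>a\<close> integrated over \<open>b \<inter> g\<close>,
  where \<open>u\<close> may replace \<open>a\<close>; then \<open>u\<close> times the indicator of
  \<open>g\<close> is \<open>F\<close>-measurable and can be pulled out. \<open>F\<close> is left
  open because it is instantiated both by a \<open>sigma\<close> and by a preimage algebra.\<close>

lemma ci_imp_cond_exp_prod:
  assumes ci: "ci A B C" and I: "A \<subseteq> I" "B \<subseteq> I" "C \<subseteq> I"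
    and F: "space F = space P" "sets F = \<sigma> C" and a: "a \<in> \<sigma> A" and b: "b \<in> \<sigma> B"
  shows "AE \<omega> in P. real_cond_exp P F (indicator (a \<inter> b)) \<omega> =
    real_cond_exp P F (indicator a) \<omega> * real_cond_exp P F (indicator b) \<omega>"
proof -
  interpret F: finite_measure_subalgebra P F using I(3) F by (rule subalgebraI)
  obtain u where u: "u \<in> borel_measurable F" "integrable P u"
    "\<And>E. E \<in> \<sigma> (B \<union> C) \<Longrightarrow> (LINT \<omega>:E|P. indicat_real a \<omega>) = (LINT \<omega>:E|P. u \<omega>)"
    using ci a unfolding indep_given_def measurable_gen_events_cong[OF F] by blast
  have m [measurable]: "a \<in> sets P" "b \<in> sets P" using a b I gen_events_subset_sets by blast+
  have g: "g \<in> sets P" if "g \<in> sets F" for g using that F I gen_events_subset_sets by blast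
  have CB: "\<sigma> C \<subseteq> \<sigma> (B \<union> C)" "\<sigma> B \<subseteq> \<sigma> (B \<union> C)" by (auto intro: gen_events_mono[THEN subsetD])
  have 1: "AE \<omega> in P. real_cond_exp P F (indicator a) \<omega> = u \<omega>"
    using u CB F by (intro F.real_cond_exp_charact) (auto simp: integrable_indicat)
  have ub: "integrable P (\<lambda>\<omega>. u \<omega> * indicator b \<omega>)"
    using integrable_mult_indicator[OF m(2) u(2)] by (simp add: mult.commute)
  have "AE \<omega> in P. real_cond_exp P F (indicator (a \<inter> b)) \<omega> = u \<omega> * real_cond_exp P F (indicator b) \<omega>"
  proof (rule F.real_cond_exp_charact)
    fix g assume g': "g \<in> sets F"
    note [measurable] = g[OF g'] u(1)
    have um [measurable]: "u \<in> borel_measurable P" using u(2) by auto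
    have "(LINT \<omega>:g|P. indicat_real (a \<inter> b) \<omega>) = (LINT \<omega>:(b \<inter> g)|P. indicat_real a \<omega>)"
      unfolding set_lebesgue_integral_def by (intro Bochner_Integration.integral_cong) (auto simp: indicator_def)
    \<comment> \<open>Testing on events of \<open>B \<union> C\<close>, and not of \<open>C\<close>
      alone, is what allows this replacement.\<close>
    also have "\<dots> = (LINT \<omega>:(b \<inter> g)|P. u \<omega>)"
      using g' F b CB by (intro u(3) gen_events_Int) auto
    also have "\<dots> = (LINT \<omega>|P. (indicator g \<omega> * u \<omega>) * indicator b \<omega>)"
      unfolding set_lebesgue_integral_def by (intro Bochner_Integration.integral_cong) (auto simp: indicator_def)
    also have "\<dots> = (LINT \<omega>|P. (indicator g \<omega> * u \<omega>) * real_cond_exp P F (indicator b) \<omega>)"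
    proof (rule F.real_cond_exp_intg(2)[symmetric])
      show "integrable P (\<lambda>\<omega>. indicat_real g \<omega> * u \<omega> * indicat_real b \<omega>)"
        using integrable_mult_indicator[OF g[OF g'] ub] by (simp add: mult.assoc)
      show "(\<lambda>\<omega>. indicat_real g \<omega> * u \<omega>) \<in> borel_measurable F"
        using g' u(1) by measurable
    qed simp
    also have "\<dots> = (LINT \<omega>:g|P. u \<omega> * real_cond_exp P F (indicator b) \<omega>)"
      unfolding set_lebesgue_integral_def by (simp add: mult.assoc)
    finally show "(LINT \<omega>:g|P. indicat_real (a \<inter> b) \<omega>) = (LINT \<omega>:g|P. u \<omega> * real_cond_exp P F (indicator b) \<omega>)" .
  next
    show "integrable P (\<lambda>\<omega>. u \<omega> * real_cond_exp P F (indicator b) \<omega>)"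
      using F.real_cond_exp_intg(1)[OF ub u(1)] by simp
  qed (use u(1) in \<open>auto simp: integrable_indicat\<close>)
  then show ?thesis using 1 by eventually_elim simp
qed

text \<open>The witness for \<open>b\<close> is its conditional expectation. It needs testing only
  on intersections \<open>a \<inter> g\<close>, where the product formula and the pull-out property,
  used twice, move the conditional expectation from \<open>a\<close> to \<open>b\<close>. As the
  product formula is symmetric in \<open>A\<close> and \<open>B\<close>, the swapped conclusion
  yields \<open>ci_sym\<close>.\<close>

lemma cond_exp_prod_imp_ci:
  assumes I: "A \<subseteq> I" "B \<subseteq> I" "C \<subseteq> I"
    and F: "space F = space P" "sets F = \<sigma> C"
    and prod: "\<And>a b. a \<in> \<sigma> A \<Longrightarrow> b \<in> \<sigma> B \<Longrightarrow> AE \<omega> in P. real_cond_exp P F (indicator (a \<inter> b)) \<omega> =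
      real_cond_exp P F (indicator a) \<omega> * real_cond_exp P F (indicator b) \<omega>"
  shows "ci B A C"
  unfolding indep_given_def
proof
  interpret F: finite_measure_subalgebra P F using I(3) F by (rule subalgebraI)
  fix b assume b: "b \<in> \<sigma> B"
  then have mb [measurable]: "b \<in> sets P" using I gen_events_subset_sets by blast
  let ?u = "real_cond_exp P F (indicator b)"
  let ?E = "{a \<inter> g |a g. a \<in> \<sigma> A \<and> g \<in> \<sigma> C}"
  have iu: "integrable P ?u" by (rule F.real_cond_exp_int(1)) (simp add: integrable_indicat)
  have "(LINT \<omega>:E|P. indicator b \<omega>) = (LINT \<omega>:E|P. ?u \<omega>)" if E: "E \<in> \<sigma> (A \<union> C)" for E
  proof (rule set_lebesgue_integral_eq_on_sigma_sets[of ?E])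
    show "Int_stable ?E" by (rule Int_stable_gen_events_Int)
    show "?E \<subseteq> sets P" using I gen_events_subset_sets by blast
    show "space P \<in> ?E" using space_in_gen_events by blast
    show "E \<in> sigma_sets (space P) ?E" using E by (simp add: gen_events_Un)
    show "integrable P (indicat_real b)" by (simp add: integrable_indicat)
    show "integrable P ?u" by fact
    fix e assume "e \<in> ?E"
    then obtain a g where e: "e = a \<inter> g" and a: "a \<in> \<sigma> A" and g: "g \<in> \<sigma> C" by blast
    have m [measurable]: "a \<in> sets P" "g \<in> sets P" "g \<in> sets F" using a g F I gen_events_subset_sets by blast+
    have "(LINT \<omega>:e|P. indicat_real b \<omega>) = (LINT \<omega>|P. indicator g \<omega> * indicat_real (a \<inter> b) \<omega>)"
      unfolding set_lebesgue_integral_def e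
      by (intro Bochner_Integration.integral_cong) (auto simp: indicator_def)
    also have "\<dots> = (LINT \<omega>|P. indicator g \<omega> * real_cond_exp P F (indicat_real (a \<inter> b)) \<omega>)"
    proof (rule F.real_cond_exp_intg(2)[symmetric])
      show "integrable P (\<lambda>\<omega>. indicator g \<omega> * indicat_real (a \<inter> b) \<omega>)"
        using integrable_mult_indicator[OF m(2) integrable_indicat[of "a \<inter> b"]] m(1) mb by simp
    qed (use m mb in auto)
    also have "\<dots> = (LINT \<omega>|P. (indicator g \<omega> * ?u \<omega>) * real_cond_exp P F (indicat_real a) \<omega>)"
    proof (rule integral_cong_AE)
      show "AE \<omega> in P. indicator g \<omega> * real_cond_exp P F (indicat_real (a \<inter> b)) \<omega> =
          (indicator g \<omega> * ?u \<omega>) * real_cond_exp P F (indicat_real a) \<omega>"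
        using prod[OF a b] by eventually_elim simp
    qed auto
    also have "\<dots> = (LINT \<omega>|P. (indicator g \<omega> * ?u \<omega>) * indicat_real a \<omega>)"
    proof (rule F.real_cond_exp_intg(2))
      show "integrable P (\<lambda>\<omega>. indicator g \<omega> * ?u \<omega> * indicat_real a \<omega>)"
        using integrable_mult_indicator[OF m(1) integrable_mult_indicator[OF m(2) iu]]
        by (simp add: mult_ac)
    qed (use m in \<open>auto intro: borel_measurable_cond_exp\<close>)
    also have "\<dots> = (LINT \<omega>:e|P. ?u \<omega>)"
      unfolding set_lebesgue_integral_def e
      by (intro Bochner_Integration.integral_cong) (auto simp: indicator_def)
    finally show "(LINT \<omega>:e|P. indicat_real b \<omega>) = (LINT \<omega>:e|P. ?u \<omega>)" .
  qed
  then show "\<exists>u :: 'w \<Rightarrow> real \<in> borel_measurable (sigma (space P) (\<sigma> C)). integrable P u \<and>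
      (\<forall>E\<in>\<sigma> (A \<union> C). (LINT \<omega>:E|P. indicator b \<omega>) = (LINT \<omega>:E|P. u \<omega>))"
    using iu unfolding measurable_gen_events_cong[OF F]
    by (intro bexI[of _ ?u] conjI ballI borel_measurable_cond_exp)
qed

lemma ci_sym:
  assumes "ci A B C" "A \<subseteq> I" "B \<subseteq> I" "C \<subseteq> I"
  shows "ci B A C"
  using assms ci_imp_cond_exp_prod[OF assms, of "sigma (space P) (\<sigma> C)"]
  by (intro cond_exp_prod_imp_ci[of A B C "sigma (space P) (\<sigma> C)"])
    (auto simp: space_measure_of_conv)

lemma ci_imp_cond_indep:
  assumes "ci A B C" and I: "A \<subseteq> I" "B \<subseteq> I" "C \<subseteq> I"
  shows "cond_indep P N Z A B C"
proof -
  let ?F = "vimage_algebra (space P) (joint_rv Z C) (PiM C N)"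
  have *: "joint_rv Z S -` T \<inter> space P \<in> \<sigma> S" if "S \<subseteq> I" "T \<in> sets (PiM S N)" for S T
    using sets_vimage_algebra_joint_rv[OF that(1)] in_vimage_algebra[OF that(2)] by metis
  have "joint_rv Z A -` SA \<inter> joint_rv Z B -` SB \<inter> space P =
      (joint_rv Z A -` SA \<inter> space P) \<inter> (joint_rv Z B -` SB \<inter> space P)" for SA SB by auto
  then show ?thesis
    unfolding cond_indep_def Let_def
    using ci_imp_cond_exp_prod[OF assms, of ?F] sets_vimage_algebra_joint_rv[OF I(3)] * I
    by (simp add: space_vimage_algebra)
qed

text \<open>By independence the conditional expectation of the indicator of \<open>x\<close> given
  the family on \<open>S\<close> is the constant \<open>prob x\<close>; pulling out \<open>f\<close>
  gives the claim.\<close>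

lemma integral_mult_indicator_indep:
  assumes S: "S \<subseteq> I" and f: "f \<in> borel_measurable (sigma (space P) (\<sigma> S))" "integrable P f"
    and x: "x \<in> sets P" and ind: "\<And>E. E \<in> \<sigma> S \<Longrightarrow> prob (x \<inter> E) = prob x * prob E"
  shows "(LINT \<omega>:x|P. f \<omega>) = prob x * (LINT \<omega>|P. f \<omega>)"
proof -
  let ?G = "sigma (space P) (\<sigma> S)"
  interpret G: finite_measure_subalgebra P ?G using S by (rule subalgebraI) (auto simp: space_measure_of_conv)
  note [measurable] = x
  have "AE \<omega> in P. real_cond_exp P ?G (indicator x) \<omega> = prob x"
  proof (rule G.real_cond_exp_charact)
    fix E assume "E \<in> sets ?G"
    then have E: "E \<in> \<sigma> S" "E \<in> sets P" using S gen_events_subset_sets by auto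
    have "(LINT \<omega>:E|P. indicat_real x \<omega>) = (LINT \<omega>|P. indicat_real (x \<inter> E) \<omega>)"
      unfolding set_lebesgue_integral_def by (intro Bochner_Integration.integral_cong) (auto simp: indicator_def)
    also have "\<dots> = prob x * prob E" using E x by (simp add: ind)
    also have "\<dots> = (LINT \<omega>:E|P. prob x)" using E by (simp add: set_lebesgue_integral_def)
    finally show "(LINT \<omega>:E|P. indicat_real x \<omega>) = (LINT \<omega>:E|P. prob x)" .
  qed (auto simp: integrable_indicat)
  then have "(LINT \<omega>|P. f \<omega> * real_cond_exp P ?G (indicator x) \<omega>) = (LINT \<omega>|P. f \<omega> * prob x)"
    using f by (intro integral_cong_AE) auto
  moreover have "(LINT \<omega>|P. f \<omega> * real_cond_exp P ?G (indicator x) \<omega>) = (LINT \<omega>|P. f \<omega> * indicator x \<omega>)"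
    using integrable_mult_indicator[OF x f(2)] f
    by (intro G.real_cond_exp_intg(2)) (auto simp: mult.commute)
  ultimately show ?thesis by (simp add: set_lebesgue_integral_def mult.commute)
qed

text \<open>The witness \<open>u\<close> stays. On an intersection of an event \<open>e\<close> of
  \<open>B \<union> C\<close> with an event \<open>x\<close> of \<open>D\<close>, the integrals of
  \<open>u\<close> and of the indicator of \<open>a\<close> both acquire the factor
  \<open>prob x\<close>. Independence is asked from \<open>A\<close> too, since \<open>a\<close> is
  one of the integrands.\<close>

lemma ci_insert_independent:
  assumes ci: "ci A B C" and I: "A \<subseteq> I" "B \<subseteq> I" "C \<subseteq> I" "D \<subseteq> I"
    and ind: "\<And>x E. x \<in> \<sigma> D \<Longrightarrow> E \<in> \<sigma> (A \<union> B \<union> C) \<Longrightarrow> prob (x \<inter> E) = prob x * prob E"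
  shows "ci A (B \<union> D) C"
  unfolding indep_given_def
proof
  fix a assume a: "a \<in> \<sigma> A"
  obtain u where u: "u \<in> borel_measurable (sigma (space P) (\<sigma> C))" "integrable P u"
    "\<And>E. E \<in> \<sigma> (B \<union> C) \<Longrightarrow> (LINT \<omega>:E|P. indicat_real a \<omega>) = (LINT \<omega>:E|P. u \<omega>)"
    using ci a unfolding indep_given_def by blast
  have ma: "a \<in> sets P" using a I gen_events_subset_sets by blast
  let ?S = "A \<union> B \<union> C"
  let ?E = "{e \<inter> x |e x. e \<in> \<sigma> (B \<union> C) \<and> x \<in> \<sigma> D}"
  have S: "?S \<subseteq> I" using I by auto
  have sub: "\<sigma> A \<subseteq> \<sigma> ?S" "\<sigma> (B \<union> C) \<subseteq> \<sigma> ?S" "\<sigma> C \<subseteq> \<sigma> ?S" by (intro gen_events_mono; auto)+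
  have "borel_measurable (sigma (space P) (\<sigma> C)) \<subseteq> (borel_measurable (sigma (space P) (\<sigma> ?S)) :: ('w \<Rightarrow> real) set)"
    using sub by (intro measurable_mono) (auto simp: space_measure_of_conv)
  then have uS: "u \<in> borel_measurable (sigma (space P) (\<sigma> ?S))" using u(1) by blast
  have "(LINT \<omega>:E|P. indicator a \<omega>) = (LINT \<omega>:E|P. u \<omega>)" if E: "E \<in> \<sigma> (B \<union> D \<union> C)" for E
  proof (rule set_lebesgue_integral_eq_on_sigma_sets[of ?E])
    show "Int_stable ?E" by (rule Int_stable_gen_events_Int)
    show "?E \<subseteq> sets P" using I gen_events_subset_sets[of "B \<union> C"] gen_events_subset_sets[of D] by blast
    show "space P \<in> ?E" using space_in_gen_events by blast
    have "B \<union> D \<union> C = (B \<union> C) \<union> D" by auto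
    then show "E \<in> sigma_sets (space P) ?E" using E gen_events_Un[of P N Z "B \<union> C" D] by simp
    show "integrable P (indicat_real a)" using ma by (simp add: integrable_indicat)
    show "integrable P u" by fact
    fix e' assume "e' \<in> ?E"
    then obtain e x where e': "e' = e \<inter> x" and e: "e \<in> \<sigma> (B \<union> C)" and x: "x \<in> \<sigma> D" by blast
    have m: "e \<in> sets P" "x \<in> sets P" using e x I gen_events_subset_sets[of "B \<union> C"] gen_events_subset_sets[of D] by blast+
    have eS: "e \<in> sets (sigma (space P) (\<sigma> ?S))" "a \<in> sets (sigma (space P) (\<sigma> ?S))" using e a sub by auto
    have *: "(LINT \<omega>:e'|P. k \<omega>) = prob x * (LINT \<omega>:e|P. k \<omega>)"
      if k: "k \<in> borel_measurable (sigma (space P) (\<sigma> ?S))" "integrable P k" for k :: "'w \<Rightarrow> real"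
    proof -
      have "(LINT \<omega>:e'|P. k \<omega>) = (LINT \<omega>:x|P. indicator e \<omega> * k \<omega>)"
        unfolding set_lebesgue_integral_def e'
        by (intro Bochner_Integration.integral_cong) (auto simp: indicator_def)
      also have "\<dots> = prob x * (LINT \<omega>|P. indicator e \<omega> * k \<omega>)"
      proof (rule integral_mult_indicator_indep[OF S _ _ m(2) ind[OF x]])
        show "(\<lambda>\<omega>. indicat_real e \<omega> * k \<omega>) \<in> borel_measurable (sigma (space P) (\<sigma> ?S))"
          using eS k(1) by measurable
        show "integrable P (\<lambda>\<omega>. indicat_real e \<omega> * k \<omega>)"
          using integrable_mult_indicator[OF m(1) k(2)] by simp
      qed
      finally show ?thesis by (simp add: set_lebesgue_integral_def)
    qed
    have "indicat_real a \<in> borel_measurable (sigma (space P) (\<sigma> ?S))"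
      using eS(2) by (rule borel_measurable_indicator)
    moreover have "integrable P (indicat_real a)" using ma by (simp add: integrable_indicat)
    ultimately show "(LINT \<omega>:e'|P. indicat_real a \<omega>) = (LINT \<omega>:e'|P. u \<omega>)"
      using *[of "indicator a"] *[OF uS u(2)] u(3)[OF e] by simp
  qed
  then show "\<exists>u :: 'w \<Rightarrow> real \<in> borel_measurable (sigma (space P) (\<sigma> C)). integrable P u \<and>
      (\<forall>E\<in>\<sigma> (B \<union> D \<union> C). (LINT \<omega>:E|P. indicator a \<omega>) = (LINT \<omega>:E|P. u \<omega>))"
    using u(1,2) by (intro bexI[of _ u] conjI ballI)
qed

end

section \<open>The global Markov property of deterministic models\<close>

text \<open>Enlarging the conditioning set can only open colliders, so it suffices that the new
  vertex is never an inner non-collider.\<close>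

lemma inner_open_insert:
  assumes "inner_open D C w"
    and "\<And>us x y z vs. w = us @ x # y # z # vs \<Longrightarrow> \<not> ((x, y) \<in> D \<and> (z, y) \<in> D) \<Longrightarrow> y \<noteq> v"
  shows "inner_open D (insert v C) w"
  using assms
proof (induction D C w rule: inner_open.induct)
  case (1 D C x y z zs)
  have "inner_open D (insert v C) (y # z # zs)"
  proof (rule 1(1))
    show "inner_open D C (y # z # zs)" using 1(2) by simp
    show "\<And>us x' y' z' vs. y # z # zs = us @ x' # y' # z' # vs \<Longrightarrow>
       \<not> ((x', y') \<in> D \<and> (z', y') \<in> D) \<Longrightarrow> y' \<noteq> v"
      using 1(3) by (metis append_Cons)
  qed
  moreover have "triple_open D (insert v C) x y z"
    using 1(2) 1(3)[of "[]" x y z zs] anc_mono[of C "insert v C" D]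
    by (auto simp: triple_open_def split: if_splits)
  ultimately show ?case using 1(2) by simp
qed auto

section \<open>Sinks of ancestral sets\<close>

definition ancestral :: "('a \<times> 'a) set \<Rightarrow> 'a set \<Rightarrow> bool" where
  "ancestral D L \<longleftrightarrow> (\<forall>(u, v)\<in>D. v \<in> L \<longrightarrow> u \<in> L)"

text \<open>Relative to \<open>L\<close>: children of \<open>v\<close> outside \<open>L\<close> are
  allowed, so the graph need not be cut down during the induction.\<close>

definition sink :: "('a \<times> 'a) set \<Rightarrow> 'a set \<Rightarrow> 'a \<Rightarrow> bool" where
  "sink D L v \<longleftrightarrow> v \<in> L \<and> (\<forall>u\<in>L. (v, u) \<notin> D)"

definition separated :: "('a \<times> 'a) set \<Rightarrow> 'a set \<Rightarrow> 'a set \<Rightarrow> 'a set \<Rightarrow> bool" where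
  "separated D A B C \<longleftrightarrow> (\<forall>a\<in>A. \<forall>b\<in>B. \<not> connected_given D C a b)"

lemma separated_sym: "separated D A B C \<Longrightarrow> separated D B A C"
  unfolding separated_def using connected_given_sym by metis

lemma ancestral_rtrancl: "(u, x) \<in> D\<^sup>* \<Longrightarrow> ancestral D L \<Longrightarrow> x \<in> L \<Longrightarrow> u \<in> L"
  by (induction rule: converse_rtrancl_induct) (auto simp: ancestral_def)

lemma ancestral_sink_remove: "ancestral D L \<Longrightarrow> sink D L v \<Longrightarrow> ancestral D (L - {v})"
  by (auto simp: ancestral_def sink_def)

text \<open>A directed path that ends in \<open>L\<close> lies in \<open>L\<close> by ancestrality,
  but its first edge from \<open>v\<close> would leave \<open>L\<close>.\<close>

lemma sink_trancl: "ancestral D L \<Longrightarrow> sink D L v \<Longrightarrow> x \<in> L \<Longrightarrow> (v, x) \<notin> D\<^sup>+"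
  using ancestral_rtrancl[of _ x D L] by (metis sink_def tranclD)

lemma sink_not_anc: "ancestral D L \<Longrightarrow> sink D L v \<Longrightarrow> C \<subseteq> L - {v} \<Longrightarrow> v \<notin> anc D C"
  unfolding anc_def using sink_trancl[of D L v] by (auto simp: rtrancl_eq_or_trancl)

lemma sink_exists:
  assumes "finite L" "L \<noteq> {}" "acyclic D"
  shows "\<exists>v. sink D L v"
proof -
  have "wf ((D \<inter> L \<times> L)\<inverse>)"
    using assms by (intro finite_acyclic_wf_converse) (auto intro: acyclic_subset)
  moreover obtain x where "x \<in> L" using assms(2) by blast
  ultimately obtain v where v: "v \<in> L" "\<And>u. (u, v) \<in> (D \<inter> L \<times> L)\<inverse> \<Longrightarrow> u \<notin> L"
    using wfE_min[of "(D \<inter> L \<times> L)\<inverse>" x L] by blast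
  have "(v, u) \<notin> D" if "u \<in> L" for u using v(1) v(2)[of u] that by auto
  then show ?thesis using v(1) unfolding sink_def by blast
qed

lemma ancestral_induct [consumes 3, case_names empty sink]:
  assumes "finite L" "ancestral D L" "acyclic D"
    and empty: "P {}"
    and step: "\<And>L v. ancestral D L \<Longrightarrow> sink D L v \<Longrightarrow> finite L \<Longrightarrow> P (L - {v}) \<Longrightarrow> P L"
  shows "P L"
  using assms(1,2)
proof (induction L rule: finite_psubset_induct)
  case (psubset L)
  show ?case
  proof (cases "L = {}")
    case False
    then obtain v where v: "sink D L v" using sink_exists psubset assms(3) by metis
    then have "L - {v} \<subset> L" by (auto simp: sink_def)
    then show ?thesis using psubset v ancestral_sink_remove step by metis
  qed (use empty in simp)
qed

text \<open>Prefix \<open>v\<close> to the walk: \<open>p\<close> becomes an inner non-collider,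
  because \<open>v\<close> to \<open>p\<close> is not an edge, and it is outside \<open>C\<close>.
  By contraposition the parents of a separated vertex are separated too.\<close>

lemma connected_given_child:
  assumes "acyclic D" "(p, v) \<in> D" "v \<notin> C" "connected_given D C p b"
  shows "connected_given D C v b"
proof -
  obtain w where w: "w \<noteq> []" "hd w = p" "last w = b" "inner_open D C w" "p \<notin> C" "b \<notin> C"
    using assms(4) by (auto simp: connected_given_def)
  obtain ws where ws: "w = p # ws" using w by (cases w) auto
  have "(v, p) \<notin> D" using assms(1,2) unfolding acyclic_def by (meson r_into_trancl trancl_into_trancl)
  then have "inner_open D C (v # w)"
    using w ws assms(2) by (cases ws) (auto simp: triple_open_def adjacent_def)
  then show ?thesis
    using w assms(3) unfolding connected_given_def by (metis last_ConsR list.discI list.sel(1))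
qed

text \<open>A sink \<open>v\<close> is never an inner non-collider here: leaving \<open>v\<close> along an outgoing edge would make
  it a proper ancestor of \<open>L\<close>.\<close>
lemma sink_inner_open_insert:
  assumes L: "ancestral D L" "sink D L v" and C: "C \<subseteq> L - {v}"
    and w: "inner_open D C w" "w \<noteq> []" "hd w \<in> L" "last w \<in> L"
  shows "inner_open D (insert v C) w"
proof (rule inner_open_insert[OF w(1)])
  have no_out: "(v, z) \<notin> D" if "inner_open D C (us @ v # z # vs)" "last (z # vs) \<in> L" for us z vs
  proof
    assume "(v, z) \<in> D"
    moreover have "inner_open D C (v # z # vs)" using that(1) inner_open_append by metis
    ultimately have "v \<in> anc D C \<or> (v, last (z # vs)) \<in> D\<^sup>+" by (rule inner_open_follow[rotated])
    then show False using sink_trancl[OF L that(2)] sink_not_anc[OF L C] by blast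
  qed
  fix us x y z vs
  assume eq: "w = us @ x # y # z # vs" and nc: "\<not> ((x, y) \<in> D \<and> (z, y) \<in> D)"
  show "y \<noteq> v"
  proof
    assume y: "y = v"
    have "inner_open D C ((us @ [x]) @ v # z # vs)" using w(1) eq y by simp
    moreover have "last (z # vs) \<in> L" using w(4) eq by simp
    ultimately have 1: "(v, z) \<notin> D" by (rule no_out)
    have "inner_open D C (rev w)" using w(1) by (simp add: inner_open_rev)
    then have "inner_open D C ((rev vs @ [z]) @ v # x # rev us)" using eq y by simp
    moreover have "last (x # rev us) \<in> L" using w(3) eq by (cases us) auto
    ultimately have 2: "(v, x) \<notin> D" by (rule no_out)
    have "adjacent D x v" "adjacent D v z"
      using inner_open_adjacent[OF w(1), of "length us"] inner_open_adjacent[OF w(1), of "Suc (length us)"] eq y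
      by (auto simp: nth_append)
    then show False using 1 2 nc y by (auto simp: adjacent_def)
  qed
qed

text \<open>Read contrapositively: dropping a sink from the conditioning set preserves separation.
  For a general vertex this fails, as dropping it may open non-colliders.\<close>

lemma connected_given_insert_sink:
  assumes L: "ancestral D L" "sink D L v" and C: "C \<subseteq> L - {v}"
    and ab: "a \<in> L - {v}" "b \<in> L - {v}" and con: "connected_given D C a b"
  shows "connected_given D (insert v C) a b"
  using con ab sink_inner_open_insert[OF L C] unfolding connected_given_def by blast

text \<open>Glue the two walks at \<open>v\<close>. Both enter \<open>v\<close> through an
  arrowhead, so \<open>v\<close> is a collider of the glued walk, and it is open since
  \<open>v\<close> is now conditioned on.\<close>

lemma connected_given_via_sink:
  assumes L: "ancestral D L" "sink D L v" and C: "C \<subseteq> L - {v}"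
    and ab: "a \<in> L - {v}" "b \<in> L - {v}"
    and av: "connected_given D C a v" and vb: "connected_given D C b v"
  shows "connected_given D (insert v C) a b"
proof -
  have arrow: "\<exists>us. us \<noteq> [] \<and> hd us = x \<and> inner_open D (insert v C) (us @ [v]) \<and> (last us, v) \<in> D \<and> x \<notin> C"
    if x: "x \<in> L - {v}" "connected_given D C x v" for x
  proof -
    obtain w where w: "w \<noteq> []" "hd w = x" "last w = v" "inner_open D C w" "x \<notin> C"
      using x by (auto simp: connected_given_def)
    define us where "us = butlast w"
    have wu: "w = us @ [v]" using w by (simp add: us_def) (metis append_butlast_last_id)
    have us: "us \<noteq> []" using wu w x by auto
    \<comment> \<open>Otherwise the reversed walk leaves \<open>v\<close> along an arrow and ends at
      \<open>x\<close> in \<open>L\<close>, which is impossible for a sink.\<close>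
    have "(v, last us) \<notin> D"
    proof
      assume "(v, last us) \<in> D"
      moreover have "rev us = last us # tl (rev us)" using us by (simp add: hd_rev[symmetric])
      then have r: "rev w = v # last us # tl (rev us)" using wu by simp
      moreover have "inner_open D C (rev w)" using w by (simp add: inner_open_rev)
      moreover have "last (last us # tl (rev us)) = x"
        using \<open>rev us = _\<close> us w wu by (metis hd_append2 last_rev)
      ultimately have "v \<in> anc D C \<or> (v, x) \<in> D\<^sup>+" using inner_open_follow by metis
      then show False using sink_trancl[OF L, of x] x sink_not_anc[OF L C] by blast
    qed
    moreover have "butlast us @ last us # [v] = w" using us wu by simp
    then have "inner_open D C (butlast us @ last us # [v])" using w by simp
    then have "adjacent D (last us) v" using inner_open_append[of D C "butlast us" "last us" "[v]"] by simp
    moreover have "inner_open D (insert v C) w"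
      using sink_inner_open_insert[OF L C w(4)] w x L(2) by (auto simp: sink_def)
    ultimately show ?thesis using us w wu by (auto simp: adjacent_def intro!: exI[of _ us])
  qed
  obtain us where us: "us \<noteq> []" "hd us = a" "inner_open D (insert v C) (us @ [v])" "(last us, v) \<in> D" "a \<notin> C"
    using arrow[OF ab(1) av] by blast
  obtain vs where vs: "vs \<noteq> []" "hd vs = b" "inner_open D (insert v C) (vs @ [v])" "(last vs, v) \<in> D" "b \<notin> C"
    using arrow[OF ab(2) vb] by blast
  have "inner_open D (insert v C) (v # rev vs)"
    using vs(3) inner_open_rev[of D "insert v C" "vs @ [v]"] by simp
  moreover have "triple_open D (insert v C) (last us) v (hd (rev vs))"
    using us vs by (auto simp: triple_open_def anc_def hd_rev)
  ultimately have "inner_open D (insert v C) (us @ v # rev vs)"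
    using us by (subst inner_open_append) auto
  moreover have "last (us @ v # rev vs) = b" using vs by (simp add: last_rev)
  ultimately show ?thesis
    using us vs ab unfolding connected_given_def by (auto intro!: exI[of _ "us @ v # rev vs"])
qed

context random_family
begin

text \<open>An event determined by the conditioning family is its own conditional
  probability.\<close>

lemma ci_subset_left: "A \<subseteq> C \<Longrightarrow> C \<subseteq> I \<Longrightarrow> ci A B C"
  unfolding indep_given_def
proof
  fix a assume "a \<in> \<sigma> A" and A: "A \<subseteq> C" "C \<subseteq> I"
  then have "a \<in> \<sigma> C" "a \<in> sets P" using gen_events_mono[of A C P N Z] gen_events_subset_sets[of C] by auto
  then show "\<exists>u :: 'w \<Rightarrow> real \<in> borel_measurable (sigma (space P) (\<sigma> C)). integrable P u \<and>
      (\<forall>E\<in>\<sigma> (B \<union> C). (LINT \<omega>:E|P. indicator a \<omega>) = (LINT \<omega>:E|P. u \<omega>))"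
    by (intro bexI[of _ "indicator a"] conjI integrable_indicat borel_measurable_indicator) auto
qed

lemma ci_Diff_imp:
  assumes "ci (A - C) (B - C) C" and I: "A \<subseteq> I" "B \<subseteq> I" "C \<subseteq> I"
  shows "ci A B C"
proof -
  have "ci (A - C) B C" using assms(1) by (rule indep_given_mono) auto
  then have "ci B (A - C) C" using I by - (rule ci_sym, auto)
  then have "ci B A C" by (rule indep_given_mono) auto
  then show ?thesis using I by - (rule ci_sym, auto)
qed

end

section \<open>Structural models driven by independent exogenous variables\<close>

locale deterministic_model = random_family P N Z I
  for P :: "'w measure" and N :: "'v \<Rightarrow> 'x measure" and Z :: "'v \<Rightarrow> 'w \<Rightarrow> 'x" and I :: "'v set" +
  fixes D :: "('v \<times> 'v) set" and W :: "'v set"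
  assumes finite_I: "finite I" and D_subset: "D \<subseteq> I \<times> I" and acyclic_D: "acyclic D"
    and W_subset: "W \<subseteq> I" and indep_W: "indep_vars N Z W"
    and determined: "v \<in> I - W \<Longrightarrow> le {v} {u. (u, v) \<in> D}"
begin

text \<open>Unfolds the structural equations in topological order; ancestrality keeps all parents
  inside \<open>L\<close>.\<close>

lemma le_exogenous:
  assumes "L \<subseteq> I" "ancestral D L"
  shows "le L (L \<inter> W)"
proof -
  have "finite L" using assms(1) finite_I finite_subset by blast
  then show ?thesis using assms(2) acyclic_D assms(1)
  proof (induction L rule: ancestral_induct)
    case empty
    then show ?case by (intro ae_subsumed_refl) simp
  next
    case (sink L v)
    let ?L = "L - {v}"
    have v: "v \<in> L" using sink by (simp add: sink_def)
    have IH: "le ?L (L \<inter> W)"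
      using sink ae_subsumed_trans[of P N Z ?L "?L \<inter> W" "L \<inter> W"] by (auto intro: ae_subsumed_refl)
    have "le {v} (L \<inter> W)"
    proof (cases "v \<in> W")
      case True
      then show ?thesis using v by (intro ae_subsumed_refl) auto
    next
      case False
      have "{u. (u, v) \<in> D} \<subseteq> ?L" using sink v by (auto simp: ancestral_def sink_def)
      then have "le {u. (u, v) \<in> D} (L \<inter> W)" using IH ae_subsumed_refl ae_subsumed_trans by metis
      then show ?thesis using determined[of v] False v sink.prems ae_subsumed_trans by blast
    qed
    then have "le ({v} \<union> ?L) (L \<inter> W)" using IH by (rule ae_subsumed_Un)
    moreover have "{v} \<union> ?L = L" using v by auto
    ultimately show ?case by simp
  qed
qed

text \<open>Up to a null set, \<open>E\<close> depends only on the exogenous variables of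
  \<open>L\<close>, and \<open>v\<close> is not one of them.\<close>

lemma exogenous_independent:
  assumes L: "L \<subseteq> I" "ancestral D L" and v: "v \<in> W" "v \<notin> L"
    and x: "x \<in> \<sigma> {v}" and E: "E \<in> \<sigma> L"
  shows "prob (x \<inter> E) = prob x * prob E"
proof -
  obtain E' where E': "E' \<in> \<sigma> (L \<inter> W)" "AE \<omega> in P. \<omega> \<in> E \<longleftrightarrow> \<omega> \<in> E'"
    using le_exogenous[OF L, unfolded ae_subsumed_def, rule_format, OF E] by blast
  \<comment> \<open>Two disjoint blocks of exogenous variables, indexed by \<open>bool\<close>
    because \<open>indep_set\<close> is defined through \<open>case_bool\<close>.\<close>
  let ?J = "case_bool {v} (L \<inter> W)"
  have "indep_sets (\<lambda>j. \<sigma> (?J j)) UNIV"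
    unfolding gen_events_def
  proof (rule indep_sets_collect_sigma[where I = ?J and J = UNIV
        and E = "\<lambda>v. {Z v -` T \<inter> space P |T. T \<in> sets (N v)}"])
    show "indep_sets (\<lambda>v. {Z v -` T \<inter> space P |T. T \<in> sets (N v)}) (\<Union>j\<in>UNIV. ?J j)"
    proof (rule indep_sets_mono_index)
      show "indep_sets (\<lambda>v. {Z v -` T \<inter> space P |T. T \<in> sets (N v)}) W"
        using indep_W unfolding indep_vars_def2 by (rule conjunct2)
    qed (use v in \<open>auto simp: UNIV_bool\<close>)
    show "disjoint_family_on ?J UNIV"
      using v by (auto simp: disjoint_family_on_def split: bool.splits)
    show "Int_stable {Z i -` T \<inter> space P |T. T \<in> sets (N i)}" for i
    proof (rule Int_stableI)
      fix a b assume "a \<in> {Z i -` T \<inter> space P |T. T \<in> sets (N i)}" "b \<in> {Z i -` T \<inter> space P |T. T \<in> sets (N i)}"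
      then obtain S T where "a = Z i -` S \<inter> space P" "b = Z i -` T \<inter> space P" "S \<in> sets (N i)" "T \<in> sets (N i)"
        by blast
      then show "a \<inter> b \<in> {Z i -` T \<inter> space P |T. T \<in> sets (N i)}"
        by (intro CollectI exI[of _ "S \<inter> T"]) auto
    qed
  qed
  moreover have "(\<lambda>j. \<sigma> (?J j)) = case_bool (\<sigma> {v}) (\<sigma> (L \<inter> W))"
    by (rule ext) (simp split: bool.split)
  ultimately have "indep_set (\<sigma> {v}) (\<sigma> (L \<inter> W))" by (simp add: indep_set_def)
  then have *: "prob (x \<inter> E') = prob x * prob E'" using x E'(1) by (rule indep_setD)
  have "L \<inter> W \<subseteq> I" "{v} \<subseteq> I" using L W_subset v by auto
  then have m: "x \<in> sets P" "E \<in> sets P" "E' \<in> sets P"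
    using x E E'(1) L gen_events_subset_sets[of "{v}"] gen_events_subset_sets[of L] gen_events_subset_sets[of "L \<inter> W"] by blast+
  have "prob E = prob E'" using E'(2) m by (intro measure_eq_AE)
  moreover have "prob (x \<inter> E) = prob (x \<inter> E')"
    using E'(2) m by (intro measure_eq_AE) (auto elim: eventually_mono)
  ultimately show ?thesis using * by simp
qed

text \<open>The induction step when the sink occurs on the left: replace it by its parents,
  or split it off if it is exogenous.\<close>
lemma ci_sink_left:
  assumes L: "L \<subseteq> I" "ancestral D L" "sink D L v"
    and IH: "\<And>A B C. A \<subseteq> L - {v} \<Longrightarrow> B \<subseteq> L - {v} \<Longrightarrow> C \<subseteq> L - {v} \<Longrightarrow> separated D A B C \<Longrightarrow> ci A B C"
    and ABC: "A \<subseteq> L" "B \<subseteq> L - {v}" "C \<subseteq> L - {v}" and sep: "separated D A B C"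
  shows "ci A B C"
proof (cases "v \<in> A")
  case False
  then show ?thesis using IH ABC sep by (metis subset_Diff_insert Diff_empty)
next
  case True
  let ?L = "L - {v}" and ?A = "A - {v}"
  have v: "v \<in> L" "v \<in> I" using L by (auto simp: sink_def)
  have sI: "?A \<subseteq> I" "A \<subseteq> I" "B \<subseteq> I" "C \<subseteq> I" using L ABC by auto
  have sepA: "separated D ?A B C" using sep by (auto simp: separated_def)
  show ?thesis
  proof (cases "v \<in> W")
    case True
    have "ci ?A B C" using ABC sepA by (intro IH) auto
    then have "ci B ?A C" using sI by - (rule ci_sym, auto)
    moreover have "prob (x \<inter> E) = prob x * prob E" if "x \<in> \<sigma> {v}" "E \<in> \<sigma> (B \<union> ?A \<union> C)" for x E
    proof (rule exogenous_independent[OF _ _ True])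
      show "?L \<subseteq> I" "ancestral D ?L" "v \<notin> ?L" using L ancestral_sink_remove by auto
      show "x \<in> \<sigma> {v}" by fact
      show "E \<in> \<sigma> ?L" using that(2) gen_events_mono[of "B \<union> ?A \<union> C" ?L P N Z] ABC by auto
    qed
    ultimately have "ci B (?A \<union> {v}) C"
      using sI v by - (rule ci_insert_independent, auto)
    then have "ci B A C" by (rule indep_given_mono) auto
    then show ?thesis using sI by - (rule ci_sym, auto)
  next
    case False
    let ?p = "{u. (u, v) \<in> D}"
    have p: "?p \<subseteq> ?L" using L(2,3) by (auto simp: ancestral_def sink_def)
    have "v \<notin> C" using ABC by blast
    \<comment> \<open>A parent in \<open>C\<close> is not connected to anything by definition; any
      other parent connected to \<open>B\<close> would connect \<open>v\<close>.\<close>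
    then have "separated D (?A \<union> ?p) B C"
      using sep True sepA connected_given_child[OF acyclic_D, of _ v C]
      unfolding separated_def by blast
    then have c: "ci (?A \<union> ?p) B C" using ABC p by (intro IH) auto
    have "le ({v} \<union> ?A) (?A \<union> ?p)"
    proof (rule ae_subsumed_Un)
      have "le {v} ?p" using v False by (intro determined) auto
      then show "le {v} (?A \<union> ?p)" by (rule ae_subsumed_trans) (rule ae_subsumed_refl, blast)
      show "le ?A (?A \<union> ?p)" by (rule ae_subsumed_refl) auto
    qed
    moreover have "{v} \<union> ?A = A" using True by auto
    ultimately have "le A (?A \<union> ?p)" by simp
    with c show ?thesis by (rule ci_functional_left) (use sI p L in auto)
  qed
qed

lemma ci_sink_either:
  assumes L: "L \<subseteq> I" "ancestral D L" "sink D L v"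
    and IH: "\<And>A B C. A \<subseteq> L - {v} \<Longrightarrow> B \<subseteq> L - {v} \<Longrightarrow> C \<subseteq> L - {v} \<Longrightarrow> separated D A B C \<Longrightarrow> ci A B C"
    and ABC: "A \<subseteq> L" "B \<subseteq> L" "v \<notin> A \<or> v \<notin> B" "C \<subseteq> L - {v}" and sep: "separated D A B C"
  shows "ci A B C"
proof (cases "v \<in> B")
  case False
  then show ?thesis using ABC by - (rule ci_sink_left[OF L IH _ _ _ sep], auto)
next
  case True
  then have "ci B A C" using ABC separated_sym[OF sep] by - (rule ci_sink_left[OF L IH], auto)
  then show ?thesis using L ABC by - (rule ci_sym, auto)
qed

theorem separated_imp_ci:
  assumes "L \<subseteq> I" "ancestral D L" "A \<subseteq> L" "B \<subseteq> L" "C \<subseteq> L" "separated D A B C"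
  shows "ci A B C"
proof -
  have "finite L" using assms(1) finite_I finite_subset by blast
  then show ?thesis using assms(2) acyclic_D assms(1,3-)
  proof (induction L arbitrary: A B C rule: ancestral_induct)
    case empty
    then show ?case by (intro ci_subset_left) auto
  next
    case (sink L v)
    note L = sink.prems(1) sink.hyps(1,2)
    have IH: "ci A' B' C'" if "A' \<subseteq> L - {v}" "B' \<subseteq> L - {v}" "C' \<subseteq> L - {v}" "separated D A' B' C'" for A' B' C'
      using sink.IH[of A' B' C'] that L(1) by auto
    \<comment> \<open>Variables of \<open>C\<close> are stripped from both sides, so that a sink in
      \<open>C\<close> occurs nowhere else; \<open>ci_Diff_imp\<close> puts them back at the
      end.\<close>
    let ?A = "A - C" and ?B = "B - C"
    have sub: "?A \<subseteq> L" "?B \<subseteq> L" using sink.prems by auto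
    have sep: "separated D ?A ?B C" using sink.prems(5) by (auto simp: separated_def)
    have "ci ?A ?B C"
    proof (cases "v \<in> C")
      case False
      have "v \<notin> ?A \<or> v \<notin> ?B"
      proof (rule ccontr)
        assume "\<not> ?thesis"
        \<comment> \<open>The one-vertex walk: a common vertex of both sides outside
          \<open>C\<close> already violates separation.\<close>
        moreover have "connected_given D C v v"
          using False unfolding connected_given_def by (auto intro!: exI[of _ "[v]"])
        ultimately show False using sep by (auto simp: separated_def)
      qed
      then show ?thesis using sub sink.prems False sep by - (rule ci_sink_either[OF L IH], auto)
    next
      case True
      let ?C = "C - {v}"
      have C: "?C \<subseteq> L - {v}" "insert v ?C = C" using sink.prems True by auto
      have A: "?A \<subseteq> L - {v}" and B: "?B \<subseteq> L - {v}" using sub True by auto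
      have vI: "{v} \<subseteq> I" "?C \<subseteq> I" "?A \<subseteq> I" "?B \<subseteq> I" "v \<in> L" using L C A B by (auto simp: sink_def)
      have sep': "separated D ?A ?B ?C"
        using sep connected_given_insert_sink[OF L(2,3) C(1)] A B C(2) unfolding separated_def by (metis subsetD)
      consider "separated D ?A {v} ?C" | "separated D ?B {v} ?C"
        using sep connected_given_via_sink[OF L(2,3) C(1)] A B C(2) unfolding separated_def by (metis singletonD subsetD)
      then show ?thesis
      proof cases
        case 1
        have "separated D ?A (?B \<union> {v}) ?C" using 1 sep' by (auto simp: separated_def)
        \<comment> \<open>The induction hypothesis does not apply directly, since \<open>v\<close>
          now stands on the right; the treatment of a sink outside the conditioning set is
          reused.\<close>
        then have "ci ?A (?B \<union> {v}) ?C" using A B C vI by - (rule ci_sink_either[OF L IH], auto)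
        then have "ci ?A ?B (?C \<union> {v})" by (rule indep_given_weak_union)
        then show ?thesis using C(2) by simp
      next
        case 2
        have "separated D ?B (?A \<union> {v}) ?C" using 2 separated_sym[OF sep'] by (auto simp: separated_def)
        then have "ci ?B (?A \<union> {v}) ?C" using A B C vI by - (rule ci_sink_either[OF L IH], auto)
        then have "ci ?B ?A (?C \<union> {v})" by (rule indep_given_weak_union)
        then have "ci ?B ?A C" using C(2) by simp
        then show ?thesis using vI sink.prems by - (rule ci_sym, auto)
      qed
    qed
    then show ?case using sink.prems by - (rule ci_Diff_imp, auto)
  qed
qed

lemma global_markov:
  assumes "A \<subseteq> I" "B \<subseteq> I" "C \<subseteq> I" "d_separated (I, D, {}) A B C"
  shows "cond_indep P N Z A B C"
proof (rule ci_imp_cond_indep)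
  have "separated D A B C"
    unfolding separated_def
    using connected_given_imp_not_d_separated[OF acyclic_D D_subset] assms by blast
  then show "ci A B C"
    using assms D_subset by (intro separated_imp_ci[of I]) (auto simp: ancestral_def)
qed (use assms in auto)

end

section \<open>Coarse decomposition\<close>

lemma in_matching_commute: "in_matching M x y \<longleftrightarrow> in_matching M y x"
  by (auto simp: in_matching_def)

lemma bedge_commute: "bedge Vf x y \<longleftrightarrow> bedge Vf y x"
  by (auto simp: bedge_def)

lemma matchingD:
  "matching Vf U M \<Longrightarrow> (v, f) \<in> M \<Longrightarrow> (v', f') \<in> M \<Longrightarrow> v = v' \<longleftrightarrow> f = f'"
  unfolding matching_def by blast

lemma in_matching_unique:
  assumes "matching Vf U M" "in_matching M x y" "in_matching M x z"
  shows "y = z"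
  using assms(2,3) matchingD[OF assms(1)] by (auto simp: in_matching_def)

section \<open>Extending alternating paths, and what this says about the coarse
  decomposition\<close>

lemma alt_path_snoc:
  assumes p: "alt_path Vf U M p" and y: "y \<in> U" "y \<notin> set p" "bedge Vf (last p) y"
    and alt: "in_matching M (last p) y \<longleftrightarrow> even (length p)"
  shows "alt_path Vf U M (p @ [y])"
proof -
  have ne: "p \<noteq> []" using p by (simp add: alt_path_def)
  have "bedge Vf ((p @ [y]) ! i) ((p @ [y]) ! Suc i) \<and>
      (in_matching M ((p @ [y]) ! i) ((p @ [y]) ! Suc i) \<longleftrightarrow> odd i)"
    if i: "Suc i < length (p @ [y])" for i
  proof (cases "Suc i < length p")
    case True
    then show ?thesis using p by (simp add: alt_path_def nth_append)
  next
    case False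
    then have "length p = Suc i" using i by simp
    then show ?thesis using y alt ne by (simp add: nth_append last_conv_nth)
  qed
  then show ?thesis using p y by (auto simp: alt_path_def)
qed

lemma alt_path_prefix:
  assumes p: "alt_path Vf U M p" and i: "i < length p"
  shows "alt_path Vf U M (take (Suc i) p)" "hd (take (Suc i) p) = hd p"
    "last (take (Suc i) p) = p ! i"
proof -
  show "alt_path Vf U M (take (Suc i) p)"
    using p by (auto simp: alt_path_def dest: in_set_takeD)
  show "hd (take (Suc i) p) = hd p" using i by (cases p) auto
  show "last (take (Suc i) p) = p ! i" using i by (simp add: take_Suc_conv_app_nth)
qed

lemma alt_path_reach_mem:
  assumes "alt_path Vf U M p" "y \<in> set p"
  shows "\<exists>q. alt_path Vf U M q \<and> hd q = hd p \<and> last q = y"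
  using assms alt_path_prefix[OF assms(1)] by (metis in_set_conv_nth)

text \<open>After an odd number of vertices the next edge must avoid \<open>M\<close>. It does so by
  itself when \<open>y\<close> is new: the last vertex is either the unmatched start or already
  matched to its predecessor. If \<open>y\<close> is on the path, a prefix reaches it, which keeps
  vertices distinct.\<close>

lemma alt_path_extend_unmatched_edge:
  assumes m: "matching Vf U M" and p: "alt_path Vf U M p" and hd: "\<not> matched M (hd p)"
    and y: "y \<in> U" "bedge Vf (last p) y" and odd: "odd (length p)"
  shows "\<exists>q. alt_path Vf U M q \<and> hd q = hd p \<and> last q = y"
proof (cases "y \<in> set p")
  case True
  then show ?thesis using alt_path_reach_mem[OF p] by blast
next
  case False
  have ne: "p \<noteq> []" using p by (simp add: alt_path_def)
  have "\<not> in_matching M (last p) y"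
  proof
    assume M: "in_matching M (last p) y"
    have "length p \<noteq> 1"
    proof
      assume "length p = 1"
      then have "last p = hd p" by (cases p) auto
      then show False using M hd by (auto simp: matched_def)
    qed
    then obtain j where j: "length p = Suc (Suc j)" using ne odd by (cases "length p" rule: old.nat.exhaust; cases "length p - 1") auto
    then have "in_matching M (p ! j) (p ! Suc j)" using p odd by (simp add: alt_path_def)
    then have "in_matching M (last p) (p ! j)" using ne j by (simp add: last_conv_nth in_matching_commute)
    then have "y = p ! j" using in_matching_unique[OF m M] by simp
    then show False using False j by simp
  qed
  then have "alt_path Vf U M (p @ [y])" using p y False odd by (intro alt_path_snoc) auto
  then show ?thesis using ne by (intro exI[of _ "p @ [y]"]) simp
qed

lemma alt_path_extend_matched_edge:
  assumes m: "matching Vf U M" and p: "alt_path Vf U M p"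
    and M: "in_matching M (last p) y" and even: "even (length p)"
  shows "\<exists>q. alt_path Vf U M q \<and> hd q = hd p \<and> last q = y"
proof (cases "y \<in> set p")
  case True
  then show ?thesis using alt_path_reach_mem[OF p] by blast
next
  case False
  have "y \<in> U" "bedge Vf (last p) y" using m M by (auto simp: matching_def in_matching_def bedge_def)
  then have "alt_path Vf U M (p @ [y])" using p M False even by (intro alt_path_snoc) auto
  moreover have "p \<noteq> []" using p by (simp add: alt_path_def)
  ultimately show ?thesis by (intro exI[of _ "p @ [y]"]) simp
qed

lemma alt_path_side:
  assumes p: "alt_path Vf U M p" and i: "i < length p"
  shows "isl (p ! i) \<longleftrightarrow> (isl (hd p) \<longleftrightarrow> even i)"
  using i
proof (induction i)
  case 0
  then show ?case using p by (simp add: alt_path_def hd_conv_nth)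
next
  case (Suc i)
  then have "bedge Vf (p ! i) (p ! Suc i)" using p by (simp add: alt_path_def)
  then have "isl (p ! Suc i) \<longleftrightarrow> \<not> isl (p ! i)" by (auto simp: bedge_def)
  then show ?case using Suc by auto
qed

text \<open>Bipartiteness ties the end side to the parity of the length, hence to whether the next
  edge has to be in \<open>M\<close>.\<close>

lemma alt_path_last_side:
  assumes p: "alt_path Vf U M p"
  shows "isl (last p) \<longleftrightarrow> (isl (hd p) \<longleftrightarrow> odd (length p))"
proof -
  have "length p > 0" using p by (simp add: alt_path_def)
  then have "isl (p ! (length p - 1)) \<longleftrightarrow> (isl (hd p) \<longleftrightarrow> even (length p - 1))"
    by (intro alt_path_side[OF p]) simp
  moreover have "even (length p - 1) \<longleftrightarrow> odd (length p)" using \<open>length p > 0\<close> by simp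
  ultimately show ?thesis using p by (simp add: alt_path_def last_conv_nth)
qed

lemma T_I_subset: "T_I Vf U M \<subseteq> U" and T_O_subset: "T_O Vf U M \<subseteq> U"
  by (force simp: T_I_def T_O_def alt_path_def)+

text \<open>Later used contrapositively: a constraint outside \<open>T_I\<close> has no variable in
  \<open>T_I\<close>.\<close>

lemma T_I_neighbour:
  assumes m: "matching Vf U M" and v: "Inl v \<in> T_I Vf U M" "v \<in> Vf f" "Inr f \<in> U"
  shows "Inr f \<in> T_I Vf U M"
proof -
  obtain p v0 where p: "alt_path Vf U M p" "hd p = Inl v0" "\<not> matched M (Inl v0)" "last p = Inl v"
    using v(1) by (auto simp: T_I_def)
  have "odd (length p)" using alt_path_last_side[OF p(1)] p by simp
  then show ?thesis
    using alt_path_extend_unmatched_edge[OF m p(1), of "Inr f"] p v by (auto simp: T_I_def bedge_def)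
qed

lemma T_I_matched:
  assumes m: "matching Vf U M" and v: "Inr f \<in> T_I Vf U M" "(v, f) \<in> M"
  shows "Inl v \<in> T_I Vf U M"
proof -
  obtain p v0 where p: "alt_path Vf U M p" "hd p = Inl v0" "\<not> matched M (Inl v0)" "last p = Inr f"
    using v(1) by (auto simp: T_I_def)
  have "even (length p)" using alt_path_last_side[OF p(1)] p by simp
  then show ?thesis
    using alt_path_extend_matched_edge[OF m p(1), of "Inl v"] p v by (auto simp: T_I_def in_matching_def)
qed

lemma T_O_neighbour:
  assumes m: "matching Vf U M" and f: "Inr f \<in> T_O Vf U M" "v \<in> Vf f" "Inl v \<in> U"
  shows "Inl v \<in> T_O Vf U M"
proof -
  obtain p f0 where p: "alt_path Vf U M p" "hd p = Inr f0" "\<not> matched M (Inr f0)" "last p = Inr f"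
    using f(1) by (auto simp: T_O_def)
  have "odd (length p)" using alt_path_last_side[OF p(1)] p by simp
  then show ?thesis
    using alt_path_extend_unmatched_edge[OF m p(1), of "Inl v"] p f by (auto simp: T_O_def bedge_def)
qed

text \<open>Switching the first two edges of an augmenting path moves its start by two steps
  without changing the size of the matching.\<close>
lemma augmenting_path:
  assumes "matching Vf U M" "finite M" "alt_path Vf U M p" "hd p = Inl v" "\<not> matched M (Inl v)"
    "last p = Inr f" "\<not> matched M (Inr f)"
  shows "\<exists>M'. matching Vf U M' \<and> finite M' \<and> card M' = Suc (card M)"
  using assms
proof (induction "length p" arbitrary: M p v rule: less_induct)
  case less
  note m = less.prems(1) and p = less.prems(3)
  have vU: "Inl v \<in> U" using p less.prems(4) by (cases p) (auto simp: alt_path_def)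
  obtain x y r where pr: "p = x # y # r" using less.prems(3,4,6) by (cases p; cases "tl p") (auto simp: alt_path_def)
  have x: "x = Inl v" using less.prems(4) pr by simp
  have e0: "bedge Vf x y" "\<not> in_matching M x y" using p pr by (auto simp: alt_path_def dest: spec[of _ 0])
  obtain g where y: "y = Inr g" "v \<in> Vf g" using e0(1) x by (auto simp: bedge_def)
  have gU: "Inr g \<in> U" using p pr y by (simp add: alt_path_def)
  have v_un: "(v, f') \<notin> M" for f' using less.prems(5) by (auto simp: matched_def in_matching_def)
  have f_un: "(v', f) \<notin> M" for v' using less.prems(7) by (auto simp: matched_def in_matching_def)
  show ?case
  proof (cases r)
    case Nil
    then have "g = f" using less.prems(6) pr y by simp
    then have "matching Vf U (insert (v, f) M)"
      using m v_un f_un vU gU y by (auto simp: matching_def)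
    then show ?thesis using less.prems(2) v_un by (intro exI[of _ "insert (v, f) M"]) simp
  next
    case (Cons z r')
    have e1: "in_matching M y z"
      using p pr Cons by (auto simp: alt_path_def dest: spec[of _ 1])
    obtain v1 where z: "z = Inl v1" "(v1, g) \<in> M" using e1 y by (auto simp: in_matching_def)
    have vv1: "v \<noteq> v1" using v_un z by blast
    let ?M = "insert (v, g) (M - {(v1, g)})"
    have uniq: "(v', g) \<in> M \<Longrightarrow> v' = v1" "(v1, f') \<in> M \<Longrightarrow> f' = g" for v' f'
      using matchingD[OF m z(2)] by blast+
    have m': "matching Vf U ?M"
      unfolding matching_def
    proof
      show "?M \<subseteq> {(v, f). Inl v \<in> U \<and> Inr f \<in> U \<and> v \<in> Vf f}"
        using m vU gU y unfolding matching_def by auto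
      have "a = a' \<longleftrightarrow> b = b'" if "(a, b) \<in> ?M" "(a', b') \<in> ?M" for a b a' b'
        using that v_un uniq matchingD[OF m, of a b a' b'] by auto
      then show "\<forall>(a, b)\<in>?M. \<forall>(a', b')\<in>?M. a = a' \<longleftrightarrow> b = b'" by blast
    qed
    have c: "card ?M = card M" using less.prems(2) z(2) v_un card_Suc_Diff1[OF less.prems(2) z(2)] by simp
    have dist: "Inl v \<notin> set r" "Inr g \<notin> set r" using p pr x y by (auto simp: alt_path_def)
    have same: "in_matching ?M a b \<longleftrightarrow> in_matching M a b" if "a \<in> set r" "b \<in> set r" for a b
      using that dist by (auto simp: in_matching_def)
    \<comment> \<open>Two vertices are dropped, so positions keep their parity, and \<open>r\<close>
      avoids both switched edges since they contain \<open>g\<close>.\<close>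
    have r: "alt_path Vf U ?M r"
      unfolding alt_path_def
    proof (intro conjI allI impI)
      show "r \<noteq> []" using Cons by simp
      show "distinct r" "set r \<subseteq> U" using p pr by (auto simp: alt_path_def)
      fix i assume i: "Suc i < length r"
      have "bedge Vf (p ! Suc (Suc i)) (p ! Suc (Suc (Suc i)))"
        "in_matching M (p ! Suc (Suc i)) (p ! Suc (Suc (Suc i))) \<longleftrightarrow> odd (Suc (Suc i))"
        using p i pr unfolding alt_path_def by auto
      then show "bedge Vf (r ! i) (r ! Suc i)" "in_matching ?M (r ! i) (r ! Suc i) \<longleftrightarrow> odd i"
        using i pr same[of "r ! i" "r ! Suc i"] by auto
    qed
    have lr: "last r = Inr f" using less.prems(6) pr Cons by simp
    then have "g \<noteq> f" using dist Cons by (metis last_in_set list.discI)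
    then have "\<not> matched ?M (Inr f)" using f_un by (auto simp: matched_def in_matching_def)
    moreover have "(v1, f') \<notin> ?M" for f' using vv1 uniq(2)[of f'] by auto
    then have "\<not> matched ?M (Inl v1)" unfolding matched_def in_matching_def by blast
    ultimately have "\<exists>M'. matching Vf U M' \<and> finite M' \<and> card M' = Suc (card ?M)"
      using less.hyps[of r ?M v1] m' r lr less.prems(2) pr Cons z by simp
    then show ?thesis using c by simp
  qed
qed

text \<open>An unmatched constraint in \<open>T_I\<close> would give an augmenting path. Along a
  path witnessing \<open>T_O\<close>, membership in \<open>T_I\<close> is pulled back from each
  vertex to its predecessor, by the matched or the unmatched closure property of \<open>T_I\<close>,
  until it reaches the start. This avoids joining two paths that might intersect.\<close>

lemma T_I_T_O_disjoint:
  assumes mm: "max_matching Vf U M"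
  shows "T_I Vf U M \<inter> T_O Vf U M = {}"
proof -
  have m: "matching Vf U M" "finite M" using mm by (auto simp: max_matching_def)
  have unm: "Inr f \<notin> T_I Vf U M" if f: "\<not> matched M (Inr f)" for f
  proof
    assume "Inr f \<in> T_I Vf U M"
    then obtain p v where "alt_path Vf U M p" "hd p = Inl v" "\<not> matched M (Inl v)" "last p = Inr f"
      by (auto simp: T_I_def)
    then obtain M' where "matching Vf U M'" "finite M'" "card M' = Suc (card M)"
      using augmenting_path[OF m] f by blast
    then show False using mm by (auto simp: max_matching_def)
  qed
  have "x \<notin> T_I Vf U M" if "x \<in> T_O Vf U M" for x
  proof -
    obtain p f where p: "alt_path Vf U M p" "hd p = Inr f" "\<not> matched M (Inr f)" "last p = x"
      using \<open>x \<in> T_O Vf U M\<close> by (auto simp: T_O_def)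
    have "p ! i \<notin> T_I Vf U M" if "i < length p" for i
      using that
    proof (induction i)
      case 0
      then show ?case using p unm by (simp add: hd_conv_nth[symmetric])
    next
      case (Suc i)
      have e: "bedge Vf (p ! i) (p ! Suc i)" "in_matching M (p ! i) (p ! Suc i) \<longleftrightarrow> odd i" "p ! i \<in> U"
        using p(1) Suc.prems by (auto simp: alt_path_def)
      have side: "isl (p ! i) \<longleftrightarrow> odd i" using alt_path_side[OF p(1), of i] p(2) Suc.prems by simp
      show ?case
      proof
        assume T: "p ! Suc i \<in> T_I Vf U M"
        have "p ! i \<in> T_I Vf U M"
        proof (cases "odd i")
          case True
          then obtain v g where "p ! i = Inl v" "p ! Suc i = Inr g" "(v, g) \<in> M"
            using e(2) side by (auto simp: in_matching_def)
          then show ?thesis using T_I_matched[OF m(1)] T by simp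
        next
          case False
          then obtain v g where "p ! i = Inr g" "p ! Suc i = Inl v" "v \<in> Vf g"
            using e(1) side by (auto simp: bedge_def)
          then show ?thesis using T_I_neighbour[OF m(1)] T e(3) by simp
        qed
        then show False using Suc by simp
      qed
    qed
    moreover have "length p > 0" using p by (simp add: alt_path_def)
    ultimately show ?thesis using p by (metis alt_path_def diff_less last_conv_nth zero_less_one)
  qed
  then show ?thesis by blast
qed

section \<open>Clusters of the causal ordering graph\<close>

lemma components_subset: "S \<in> components Vf U \<Longrightarrow> S \<subseteq> U"
  by (auto simp: components_def)

lemma Union_components: "\<Union> (components Vf U) = U"
  by (auto simp: components_def)

lemma components_edge_closed:
  assumes "S \<in> components Vf U" "x \<in> S" "y \<in> U" "bedge Vf x y"
  shows "y \<in> S"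
  using assms by (auto simp: components_def intro: rtrancl_into_rtrancl)

lemma components_unique:
  assumes "S \<in> components Vf U" "T \<in> components Vf U" "x \<in> S" "x \<in> T"
  shows "S = T"
proof -
  let ?r = "{(a, b). a \<in> U \<and> b \<in> U \<and> bedge Vf a b}"
  have "sym ?r" using bedge_commute by (auto intro!: symI)
  then have sym: "(a, b) \<in> ?r\<^sup>* \<Longrightarrow> (b, a) \<in> ?r\<^sup>*" for a b by (meson sym_rtrancl symD)
  have "R = {y \<in> U. (x, y) \<in> ?r\<^sup>*}" if R: "R \<in> components Vf U" "x \<in> R" for R
  proof -
    obtain z where z: "R = {y \<in> U. (z, y) \<in> ?r\<^sup>*}" using R by (auto simp: components_def)
    then have "(z, x) \<in> ?r\<^sup>*" using R by blast
    then have "(z, y) \<in> ?r\<^sup>* \<longleftrightarrow> (x, y) \<in> ?r\<^sup>*" for y using sym by (meson rtrancl_trans)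
    then show ?thesis using z by simp
  qed
  from this[OF assms(1,3)] this[OF assms(2,4)] show ?thesis by simp
qed

section \<open>Clusters and edges produced by the removal algorithm\<close>

lemma alg1_step_cluster_subset:
  assumes "min_self_contained Vf R S"
  shows "S \<union> adj Vf R S \<subseteq> R" "S \<subseteq> range Inr" "adj Vf R S \<subseteq> range Inl" "adj Vf B S \<subseteq> range Inl"
  using assms by (auto simp: min_self_contained_def self_contained_def adj_def bedge_def)

lemma alg1_Union: "alg1 Vf B R Cl Ed \<Longrightarrow> \<Union> Cl = R"
proof (induction rule: alg1.induct)
  case (alg1_step R S C Cl Ed)
  then show ?case using alg1_step_cluster_subset(1)[OF alg1_step.hyps(2)] by auto
qed simp

lemma alg1_unique:
  "alg1 Vf B R Cl Ed \<Longrightarrow> S \<in> Cl \<Longrightarrow> T \<in> Cl \<Longrightarrow> x \<in> S \<Longrightarrow> x \<in> T \<Longrightarrow> S = T"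
proof (induction arbitrary: S T rule: alg1.induct)
  case (alg1_step R S' C Cl Ed)
  have "\<Union> Cl = R - C" using alg1_step.hyps(4) by (rule alg1_Union)
  then have *: "x \<in> C \<Longrightarrow> Q \<in> Cl \<Longrightarrow> x \<notin> Q" for Q by blast
  show ?case
    using alg1_step.prems alg1_step.IH[of S T] *[of S] *[of T] by auto
qed simp

lemma alg1_edges:
  "alg1 Vf B R Cl Ed \<Longrightarrow> (x, C) \<in> Ed \<Longrightarrow> C \<in> Cl \<and> x \<in> B \<and> x \<in> range Inl"
proof (induction rule: alg1.induct)
  case (alg1_step R S C' Cl Ed)
  then show ?case
    using alg1_step_cluster_subset(4)[OF alg1_step.hyps(2), of B] by (auto simp: adj_def)
qed simp

text \<open>When the cluster of \<open>f\<close> is formed, the neighbours of \<open>f\<close> still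
  present all enter it. A neighbour outside the cluster was therefore removed earlier, and exactly
  those receive an edge.\<close>

lemma alg1_complete:
  "alg1 Vf B R Cl Ed \<Longrightarrow> C \<in> Cl \<Longrightarrow> Inr f \<in> C \<Longrightarrow> Inl v \<in> B \<Longrightarrow> v \<in> Vf f \<Longrightarrow> Inl v \<notin> C \<Longrightarrow>
     (Inl v, C) \<in> Ed"
proof (induction rule: alg1.induct)
  case (alg1_step R S C' Cl Ed)
  show ?case
  proof (cases "C = C'")
    case True
    have "Inr f \<in> S" using alg1_step_cluster_subset(3)[OF alg1_step.hyps(2)] alg1_step.prems(2) alg1_step.hyps(3) True by auto
    then have "Inl v \<in> adj Vf B S" using alg1_step.prems by (auto simp: adj_def bedge_def)
    moreover have "Inl v \<notin> adj Vf R S" using alg1_step.prems(5) alg1_step.hyps(3) True by blast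
    ultimately show ?thesis using True by blast
  next
    case False
    then show ?thesis using alg1_step by blast
  qed
qed simp

text \<open>The rank is the time of removal. The restriction to \<open>x \<in> R\<close> makes the
  induction work: edges into the current cluster start at vertices removed earlier, about which
  nothing is claimed yet.\<close>

lemma alg1_rank:
  "alg1 Vf B R Cl Ed \<Longrightarrow> \<exists>r :: 'v + 'f \<Rightarrow> nat. \<forall>(x, C)\<in>Ed. \<forall>y\<in>C. x \<in> R \<longrightarrow> r x < r y"
  for Vf :: "'f \<Rightarrow> 'v set"
proof (induction rule: alg1.induct)
  case (alg1_step R S C Cl Ed)
  then obtain r :: "'v + 'f \<Rightarrow> nat" where r: "\<And>x C' y. (x, C') \<in> Ed \<Longrightarrow> y \<in> C' \<Longrightarrow> x \<in> R - C \<Longrightarrow> r x < r y"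
    by blast
  let ?r = "\<lambda>x. if x \<in> C then 0 else Suc (r x)"
  have "?r x < ?r y" if "(x, C') \<in> Ed \<union> {(x, C) |x. x \<in> adj Vf B S - adj Vf R S}" "y \<in> C'" "x \<in> R" for x C' y
  proof (cases "(x, C') \<in> Ed")
    case True
    then have "C' \<in> Cl" using alg1_edges[OF alg1_step.hyps(4)] by blast
    then have "y \<notin> C" using alg1_Union[OF alg1_step.hyps(4)] that by blast
    then show ?thesis using r[OF True that(2)] that(3) by auto
  next
    case False
    then have "x \<in> adj Vf B S - adj Vf R S" using that(1) by blast
    then show ?thesis using that(3) by (auto simp: adj_def)
  qed
  then show ?case by (intro exI[of _ ?r]) blast
qed simp

text \<open>An inner vertex of a projection path lies in \<open>L\<close> and has an outgoing edge,
  so there is none. The condition \<open>x \<noteq> y\<close> stems from distinctness of the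
  path.\<close>

lemma lp_dir_iff:
  assumes E: "\<And>x y. (x, y) \<in> E \<Longrightarrow> x \<notin> L"
  shows "lp_dir E L x y \<longleftrightarrow> (x, y) \<in> E \<and> x \<noteq> y"
proof
  assume "lp_dir E L x y"
  then obtain p where p: "distinct p" "length p \<ge> 2" "hd p = x" "last p = y"
    "\<And>i. Suc i < length p \<Longrightarrow> (p ! i, p ! Suc i) \<in> E" "\<And>i. 0 < i \<Longrightarrow> Suc i < length p \<Longrightarrow> p ! i \<in> L"
    by (auto simp: lp_dir_def)
  have "\<not> length p > 2" using p(5)[of 1] p(6)[of 1] E by auto
  then have l: "length p = 2" using p(2) by simp
  then obtain a b where "p = [a, b]" by (auto simp: length_Suc_conv numeral_2_eq_2)
  then show "(x, y) \<in> E \<and> x \<noteq> y" using p(1,3,4) p(5)[of 0] by auto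
next
  assume "(x, y) \<in> E \<and> x \<noteq> y"
  then show "lp_dir E L x y" unfolding lp_dir_def by (intro exI[of _ "[x, y]"]) auto
qed

lemma not_lp_bi:
  assumes E: "\<And>x y. (x, y) \<in> E \<Longrightarrow> x \<notin> L"
  shows "\<not> lp_bi E L x y"
  unfolding lp_bi_def using E by blast

section \<open>The acyclic graph on the retained variables\<close>

locale causal_ordering =
  fixes Vf :: "'f \<Rightarrow> 'v set" and V W :: "'v set" and F :: "'f set" and M :: "('v \<times> 'f) set"
    and Cls :: "('v + 'f) set set" and Eds :: "(('v + 'f) \<times> ('v + 'f) set) set"
  assumes W: "W \<subseteq> V" and Vf: "f \<in> F \<Longrightarrow> Vf f \<subseteq> V"
    and max_matching: "max_matching Vf (Inl ` (V - W) \<union> Inr ` F) M"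
    and CO_graph: "CO_graph Vf V F W M Cls Eds"
begin

definition "U = Inl ` (V - W) \<union> Inr ` F"
abbreviation "TI \<equiv> T_I Vf U M"
abbreviation "TO \<equiv> T_O Vf U M"
abbreviation "TC \<equiv> T_C Vf U M"
abbreviation "CV \<equiv> CO_vertices Vf V F W M"

definition "MO_edges = {(a, b). a \<in> CV \<and> b \<in> CV \<and> a \<noteq> b \<and> (Inl a, clof Cls (Inl b)) \<in> Eds}"

lemma coarse:
  "TI \<subseteq> U" "TO \<subseteq> U" "TC \<subseteq> U" "TI \<inter> TO = {}" "TI \<inter> TC = {}" "TO \<inter> TC = {}" "TI \<union> TO \<union> TC = U"
  using T_I_subset[of Vf U M] T_O_subset[of Vf U M] T_I_T_O_disjoint[OF max_matching]
  by (auto simp: T_C_def U_def)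

lemma matching: "matching Vf U M"
  using max_matching by (simp add: max_matching_def U_def)

lemma CV_iff: "v \<in> CV \<longleftrightarrow> v \<in> W \<or> Inl v \<in> TC \<or> Inl v \<in> TO"
  by (auto simp: CO_vertices_def U_def Let_def)

lemma Inl_U: "Inl v \<in> U \<longleftrightarrow> v \<in> V \<and> v \<notin> W" and Inr_U: "Inr f \<in> U \<longleftrightarrow> f \<in> F"
  by (auto simp: U_def)

lemma CV_subset: "CV \<subseteq> V"
  using W coarse Inl_U CV_iff by blast

lemma clusters:
  obtains ClC EdC where "alg1 Vf TC TC ClC EdC"
    "Cls = ClC \<union> components Vf TI \<union> components Vf TO \<union> {{Inl w} |w. w \<in> W}"
    "Eds = EdC \<union> {(Inl v, clof Cls (Inr f)) |v f. v \<in> Vf f \<and>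
               ((Inl v \<in> TO \<union> TC \<and> Inr f \<in> TI) \<or> (Inl v \<in> TO \<and> Inr f \<in> TC))}
         \<union> {(Inl w, clof Cls (Inr f)) |w f. w \<in> W \<and> f \<in> F \<and> w \<in> Vf f}"
  using CO_graph unfolding CO_graph_def Let_def U_def[symmetric] by blast

lemma cluster_cases:
  assumes "S \<in> Cls"
  shows "S \<subseteq> TC \<or> S \<in> components Vf TI \<or> S \<in> components Vf TO \<or> (\<exists>w\<in>W. S = {Inl w})"
proof -
  obtain ClC EdC where "alg1 Vf TC TC ClC EdC"
    "Cls = ClC \<union> components Vf TI \<union> components Vf TO \<union> {{Inl w} |w. w \<in> W}"
    by (rule clusters)
  then show ?thesis using assms alg1_Union[of Vf TC TC ClC EdC] by blast
qed

lemma Union_Cls: "\<Union> Cls = U \<union> Inl ` W"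
proof -
  obtain ClC EdC where *: "alg1 Vf TC TC ClC EdC"
    "Cls = ClC \<union> components Vf TI \<union> components Vf TO \<union> {{Inl w} |w. w \<in> W}"
    by (rule clusters)
  have "\<Union> Cls = TI \<union> TO \<union> TC \<union> Inl ` W"
    unfolding *(2) Union_Un_distrib alg1_Union[OF *(1)] Union_components by blast
  then show ?thesis unfolding coarse(7) .
qed

text \<open>Gives meaning to \<open>clof\<close>, which is a definite description.\<close>

lemma cluster_unique:
  assumes S: "S \<in> Cls" "x \<in> S" and T: "T \<in> Cls" "x \<in> T"
  shows "S = T"
proof -
  obtain ClC EdC where *: "alg1 Vf TC TC ClC EdC"
    "Cls = ClC \<union> components Vf TI \<union> components Vf TO \<union> {{Inl w} |w. w \<in> W}"
    by (rule clusters)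
  have W_U: "Inl w \<notin> U" if "w \<in> W" for w using that by (simp add: Inl_U)
  have kind: "(x \<in> TC \<and> R \<in> ClC) \<or> (x \<in> TI \<and> R \<in> components Vf TI) \<or> (x \<in> TO \<and> R \<in> components Vf TO)
      \<or> (x \<notin> U \<and> R = {x})" if R: "R \<in> Cls" "x \<in> R" for R
  proof -
    consider "R \<in> ClC" | "R \<in> components Vf TI" | "R \<in> components Vf TO" | w where "w \<in> W" "R = {Inl w}"
      using R(1) unfolding *(2) by blast
    then show ?thesis
    proof cases
      case 1
      then show ?thesis using alg1_Union[OF *(1)] R by blast
    next
      case 2
      then show ?thesis using components_subset[OF 2] R by blast
    next
      case 3
      then show ?thesis using components_subset[OF 3] R by blast
    next
      case 4
      then show ?thesis using W_U R by simp
    qed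
  qed
  consider "x \<in> TC" "x \<notin> TI" "x \<notin> TO" "x \<in> U" | "x \<in> TI" "x \<notin> TC" "x \<notin> TO" "x \<in> U"
    | "x \<in> TO" "x \<notin> TC" "x \<notin> TI" "x \<in> U" | "x \<notin> TI" "x \<notin> TC" "x \<notin> TO"
    using coarse by blast
  then show ?thesis
  proof cases
    case 1
    then show ?thesis using kind[OF S] kind[OF T] alg1_unique[OF *(1) _ _ S(2) T(2)] by simp
  next
    case 2
    then show ?thesis using kind[OF S] kind[OF T] components_unique[OF _ _ S(2) T(2)] by simp
  next
    case 3
    then show ?thesis using kind[OF S] kind[OF T] components_unique[OF _ _ S(2) T(2)] by simp
  next
    case 4
    then show ?thesis using kind[OF S] kind[OF T] by simp
  qed
qed

lemma clof_eq: "S \<in> Cls \<Longrightarrow> x \<in> S \<Longrightarrow> clof Cls x = S"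
  unfolding clof_def using cluster_unique by (intro the_equality) auto

lemma clof_mem: "x \<in> U \<union> Inl ` W \<Longrightarrow> clof Cls x \<in> Cls \<and> x \<in> clof Cls x"
  using Union_Cls clof_eq by (metis UnionE)

lemma Eds_source: "(x, C) \<in> Eds \<Longrightarrow> x \<in> range Inl"
proof -
  assume x: "(x, C) \<in> Eds"
  obtain ClC EdC where "alg1 Vf TC TC ClC EdC"
    "Eds = EdC \<union> {(Inl v, clof Cls (Inr f)) |v f. v \<in> Vf f \<and>
               ((Inl v \<in> TO \<union> TC \<and> Inr f \<in> TI) \<or> (Inl v \<in> TO \<and> Inr f \<in> TC))}
         \<union> {(Inl w, clof Cls (Inr f)) |w f. w \<in> W \<and> f \<in> F \<and> w \<in> Vf f}"
    by (rule clusters)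
  then show ?thesis using x alg1_edges[of Vf TC TC ClC EdC x C] by auto
qed

text \<open>Constraint vertices have no outgoing edges, so the latent projection
  just deletes them and creates no bidirected edges.\<close>
lemma induced_MO_graph: "induced_dmg (MO_graph Cls Eds) CV = (CV, MO_edges, {})"
proof -
  have E: "x \<notin> range Inr" if "(x, y) \<in> decluster Cls Eds" for x y
    using that Eds_source by (fastforce simp: decluster_def)
  have dir: "lp_dir (decluster Cls Eds) (range Inr) x y \<longleftrightarrow> (x, y) \<in> decluster Cls Eds \<and> x \<noteq> y" for x y
    by (rule lp_dir_iff) (rule E)
  have bi: "\<not> lp_bi (decluster Cls Eds) (range Inr) x y" for x y
    by (rule not_lp_bi) (rule E)
  have mem: "Inl v \<in> \<Union> Cls" if "v \<in> CV" for v
    using that Union_Cls coarse by (auto simp: CV_iff)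
  have dec: "(Inl a, Inl b) \<in> decluster Cls Eds \<longleftrightarrow> (Inl a, clof Cls (Inl b)) \<in> Eds"
    if "a \<in> CV" "b \<in> CV" for a b
    using mem that by (simp add: decluster_def)
  show ?thesis
    unfolding induced_dmg_def MO_graph_def prod.case dir MO_edges_def using bi mem dec by auto
qed

lemma acyclic_MO_edges: "acyclic MO_edges"
proof -
  obtain ClC EdC where alg: "alg1 Vf TC TC ClC EdC"
    and Cls: "Cls = ClC \<union> components Vf TI \<union> components Vf TO \<union> {{Inl w} |w. w \<in> W}"
    and Eds: "Eds = EdC \<union> {(Inl v, clof Cls (Inr f)) |v f. v \<in> Vf f \<and>
               ((Inl v \<in> TO \<union> TC \<and> Inr f \<in> TI) \<or> (Inl v \<in> TO \<and> Inr f \<in> TC))}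
         \<union> {(Inl w, clof Cls (Inr f)) |w f. w \<in> W \<and> f \<in> F \<and> w \<in> Vf f}"
    by (rule clusters)
  obtain r :: "'v + 'f \<Rightarrow> nat" where r: "\<And>x C y. (x, C) \<in> EdC \<Longrightarrow> y \<in> C \<Longrightarrow> x \<in> TC \<Longrightarrow> r x < r y"
    using alg1_rank[OF alg] by blast
  \<comment> \<open>Exogenous variables get level 0 and \<open>T_O\<close> level 1, as its only
    parents here are exogenous; \<open>T_C\<close> starts at 2 and follows the order of
    removal.\<close>
  define rk where "rk a = (if a \<in> W then 0 else if Inl a \<in> TO then 1 else 2 + r (Inl a))" for a
  have "rk a < rk b" if ab: "(a, b) \<in> MO_edges" for a b
  proof -
    let ?S = "clof Cls (Inl b)"
    have edge: "(Inl a, ?S) \<in> Eds" and b: "b \<in> CV" using ab by (auto simp: MO_edges_def)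
    have "Inl b \<in> U \<union> Inl ` W" using b coarse by (auto simp: CV_iff)
    then have S: "?S \<in> Cls" "Inl b \<in> ?S" using clof_mem by auto
    consider (alg) "(Inl a, ?S) \<in> EdC"
      | (outer) f where "?S = clof Cls (Inr f)" "(Inl a \<in> TO \<union> TC \<and> Inr f \<in> TI) \<or> (Inl a \<in> TO \<and> Inr f \<in> TC)"
      | (exo) f where "?S = clof Cls (Inr f)" "a \<in> W" "f \<in> F"
      using edge unfolding Eds by blast
    then show ?thesis
    proof cases
      case alg
      then have "?S \<in> ClC" "Inl a \<in> TC" using alg1_edges[OF \<open>alg1 Vf TC TC ClC EdC\<close>] by blast+
      then have "Inl a \<in> TC" "Inl b \<in> TC" using S alg1_Union[OF \<open>alg1 Vf TC TC ClC EdC\<close>] by blast+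
      moreover have "r (Inl a) < r (Inl b)" using r[OF alg S(2)] \<open>Inl a \<in> TC\<close> by blast
      moreover have "Inl a \<in> U" "Inl b \<in> U" using \<open>Inl a \<in> TC\<close> \<open>Inl b \<in> TC\<close> coarse by blast+
      ultimately show ?thesis using coarse by (auto simp: rk_def Inl_U)
    next
      case (outer f)
      then have "Inr f \<in> U" using coarse by blast
      then have f: "Inr f \<in> ?S" using clof_mem outer(1) by auto
      \<comment> \<open>A vertex of the graph is not in \<open>T_I\<close>, so its cluster is none
        of the components of \<open>T_I\<close> and the edge must run from \<open>T_O\<close> into
        \<open>T_C\<close>.\<close>
      have TI: "Inl b \<notin> TI" using b coarse Inl_U by (auto simp: CV_iff)
      have "Inr f \<notin> TO" using outer(2) coarse by blast
      then have "?S \<subseteq> TC"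
        using cluster_cases[OF S(1)] S(2) f TI components_subset[of ?S Vf TI] components_subset[of ?S Vf TO]
        by blast
      then have "Inl b \<in> TC" "Inl b \<in> U" "Inl b \<notin> TO" "Inl a \<in> TO" "Inl a \<in> U"
        using S f outer(2) coarse by blast+
      then show ?thesis by (simp add: rk_def Inl_U)
    next
      case (exo f)
      then have "Inr f \<in> ?S" using clof_mem[of "Inr f"] by (simp add: Inr_U)
      then have "?S \<noteq> {Inl b}" by auto
      then have "b \<notin> W" using clof_eq[of "{Inl b}" "Inl b"] Cls by blast
      then show ?thesis using exo by (simp add: rk_def)
    qed
  qed
  then have "MO_edges \<subseteq> inv_image less_than rk" by auto
  then show ?thesis using wf_acyclic[OF wf_inv_image[OF wf_less_than]] acyclic_subset by metis
qed

text \<open>Says that the arguments of the solution function of the cluster are parents of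
  \<open>v\<close>, and that the cluster is one to which unique solvability applies.\<close>

lemma cluster_of_endogenous:
  assumes v: "v \<in> CV - W"
  obtains S where "S \<in> Cls" "Inl v \<in> S" "S \<subseteq> U" "S \<inter> TI = {}"
    "\<And>f u. Inr f \<in> S \<Longrightarrow> u \<in> Vf f \<Longrightarrow> Inl u \<notin> S \<Longrightarrow> (u, v) \<in> MO_edges"
proof -
  obtain ClC EdC where alg: "alg1 Vf TC TC ClC EdC"
    and Cls: "Cls = ClC \<union> components Vf TI \<union> components Vf TO \<union> {{Inl w} |w. w \<in> W}"
    and Eds: "Eds = EdC \<union> {(Inl v, clof Cls (Inr f)) |v f. v \<in> Vf f \<and>
               ((Inl v \<in> TO \<union> TC \<and> Inr f \<in> TI) \<or> (Inl v \<in> TO \<and> Inr f \<in> TC))}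
         \<union> {(Inl w, clof Cls (Inr f)) |w f. w \<in> W \<and> f \<in> F \<and> w \<in> Vf f}"
    by (rule clusters)
  obtain S where S: "S \<in> Cls" "Inl v \<in> S"
    and S': "S \<in> ClC \<and> S \<subseteq> TC \<or> S \<in> components Vf TO \<and> S \<subseteq> TO"
  proof -
    have un: "\<Union> ClC = TC" "\<Union> (components Vf TO) = TO"
      using alg1_Union[OF alg] Union_components[of Vf TO] by simp_all
    have "Inl v \<in> \<Union> ClC \<or> Inl v \<in> \<Union> (components Vf TO)"
      unfolding un using v by (auto simp: CV_iff)
    then show ?thesis
    proof
      assume "Inl v \<in> \<Union> ClC"
      then obtain S where "S \<in> ClC" "Inl v \<in> S" by blast
      moreover have "S \<subseteq> TC" using \<open>S \<in> ClC\<close> un(1) by blast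
      ultimately show ?thesis using that[of S] unfolding Cls by blast
    next
      assume "Inl v \<in> \<Union> (components Vf TO)"
      then obtain S where "S \<in> components Vf TO" "Inl v \<in> S" by blast
      moreover have "S \<subseteq> TO" using components_subset \<open>S \<in> components Vf TO\<close> by blast
      ultimately show ?thesis using that[of S] unfolding Cls by blast
    qed
  qed
  have sub: "S \<subseteq> U" "S \<inter> TI = {}" using S' coarse by blast+
  have "(u, v) \<in> MO_edges" if f: "Inr f \<in> S" and u: "u \<in> Vf f" "Inl u \<notin> S" for f u
  proof -
    have fF: "f \<in> F" "Inr f \<in> U" using f sub Inr_U by blast+
    have uV: "u \<in> V" using Vf[OF fF(1)] u by blast
    have cl: "clof Cls (Inr f) = S" "clof Cls (Inl v) = S" using clof_eq S f by blast+
    have uv: "u \<noteq> v" using u S by blast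
    have "u \<in> CV \<and> (Inl u, S) \<in> Eds"
    proof (cases "u \<in> W")
      case True
      then have "(Inl u, clof Cls (Inr f)) \<in> Eds" using fF u unfolding Eds by blast
      then show ?thesis using True cl by (simp add: CV_iff)
    next
      case False
      then have uU: "Inl u \<in> U" using uV by (simp add: Inl_U)
      from S' show ?thesis
      proof
        assume C: "S \<in> ClC \<and> S \<subseteq> TC"
        then have fC: "Inr f \<in> TC" "Inr f \<notin> TI" using f coarse by blast+
        \<comment> \<open>Otherwise \<open>f\<close> itself would lie in \<open>T_I\<close>.\<close>
        have "Inl u \<notin> TI" using T_I_neighbour[OF matching _ u(1) fF(2)] fC by blast
        then consider "Inl u \<in> TO" | "Inl u \<in> TC" using uU coarse by blast
        then show ?thesis
        proof cases
          case 1
          then have "(Inl u, clof Cls (Inr f)) \<in> Eds" using fC u unfolding Eds by blast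
          then show ?thesis using 1 cl by (simp add: CV_iff)
        next
          case 2
          then have "(Inl u, S) \<in> EdC" using C f u by (intro alg1_complete[OF alg]) auto
          then show ?thesis using 2 by (simp add: CV_iff Eds)
        qed
      next
        \<comment> \<open>An outside endogenous variable cannot occur: the endogenous neighbours of
          a \<open>T_O\<close> constraint lie in \<open>T_O\<close>, and a component is closed under
          edges.\<close>
        assume O: "S \<in> components Vf TO \<and> S \<subseteq> TO"
        then have "Inl u \<in> TO" using T_O_neighbour[OF matching _ u(1) uU] f by blast
        then have "Inl u \<in> S"
          using O f u(1) components_edge_closed[of S Vf TO "Inr f" "Inl u"] by (simp add: bedge_def)
        then show ?thesis using u by blast
      qed
    qed
    then show ?thesis using cl uv v by (simp add: MO_edges_def)
  qed
  then show thesis using that S sub by blast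
qed

end

section \<open>The Markov property of the Markov ordering graph\<close>

lemma (in random_family) ae_subsumed_if_AE_eq:
  assumes S: "S \<subseteq> I" and v: "v \<in> R" and g: "g \<in> PiM S N \<rightarrow>\<^sub>M PiM R N"
    and eq: "AE \<omega> in P. Z v \<omega> = g (joint_rv Z S \<omega>) v"
  shows "le {v} S"
proof (rule gen_events_leI)
  fix v' T assume "v' \<in> {v}" "T \<in> sets (N v')"
  then have v': "v' = v" and T: "T \<in> sets (N v)" by auto
  let ?T = "(\<lambda>x. g x v) -` T \<inter> space (PiM S N)"
  have "(\<lambda>x. g x v) \<in> PiM S N \<rightarrow>\<^sub>M N v"
    using measurable_comp[OF g measurable_component_singleton[OF v]] by (simp add: comp_def)
  then have "?T \<in> sets (PiM S N)" using T by (rule measurable_sets)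
  then have "joint_rv Z S -` ?T \<inter> space P \<in> sets (vimage_algebra (space P) (joint_rv Z S) (PiM S N))"
    by (rule in_vimage_algebra)
  then have b: "joint_rv Z S -` ?T \<inter> space P \<in> \<sigma> S" by (simp only: sets_vimage_algebra_joint_rv[OF S])
  have js: "joint_rv Z S \<omega> \<in> space (PiM S N)" if "\<omega> \<in> space P" for \<omega>
    using measurable_space[OF measurable_Z] S that by (auto simp: joint_rv_def space_PiM)
  have "AE \<omega> in P. \<omega> \<in> Z v' -` T \<inter> space P \<longleftrightarrow> \<omega> \<in> joint_rv Z S -` ?T \<inter> space P"
    using eq by eventually_elim (use js v' in auto)
  then show "\<exists>b\<in>\<sigma> S. AE \<omega> in P. \<omega> \<in> Z v' -` T \<inter> space P \<longleftrightarrow> \<omega> \<in> b" using b by blast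
qed

lemma measurable_Xstar:
  assumes X: "\<And>w. w \<in> W \<Longrightarrow> X w \<in> P \<rightarrow>\<^sub>M N w" and h: "h \<in> PiM W N \<rightarrow>\<^sub>M PiM (V - W) N"
    and v: "v \<in> V"
  shows "Xstar W X h v \<in> P \<rightarrow>\<^sub>M N v"
proof (cases "v \<in> W")
  case True
  then have "Xstar W X h v = X v" by (auto simp: Xstar_def)
  then show ?thesis using X[OF True] by simp
next
  case False
  have "(\<lambda>\<omega>. \<lambda>w\<in>W. X w \<omega>) \<in> P \<rightarrow>\<^sub>M PiM W N" using X by (rule measurable_restrict)
  then have "(\<lambda>\<omega>. h (\<lambda>w\<in>W. X w \<omega>)) \<in> P \<rightarrow>\<^sub>M PiM (V - W) N"
    using measurable_comp[OF _ h] by (simp add: comp_def)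
  moreover have "(\<lambda>x. x v) \<in> PiM (V - W) N \<rightarrow>\<^sub>M N v"
    using v False by (intro measurable_component_singleton) auto
  ultimately have "(\<lambda>\<omega>. h (\<lambda>w\<in>W. X w \<omega>) v) \<in> P \<rightarrow>\<^sub>M N v"
    using measurable_comp by (fastforce simp: comp_def)
  moreover have "Xstar W X h v = (\<lambda>\<omega>. h (\<lambda>w\<in>W. X w \<omega>) v)" using False by (auto simp: Xstar_def)
  ultimately show ?thesis by simp
qed

text \<open>One null set of \<open>\<omega>\<close> serves all points \<open>x\<close>, so the value
  of the solution at \<open>\<omega>\<close> itself may be inserted for \<open>x\<close>. There
  \<open>comb\<close> returns \<open>Xstar\<close>, the constraints hold, and the equation with
  \<open>g\<close> follows.\<close>

lemma uniquely_solvable_wrt_Xstar: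
  assumes us: "uniquely_solvable_wrt P N W Vf X phi c SF SV"
    and SF: "SF \<subseteq> F" "\<And>f. f \<in> SF \<Longrightarrow> Vf f \<subseteq> V"
    and meas: "\<And>v. v \<in> V \<Longrightarrow> Xstar W X h v \<in> P \<rightarrow>\<^sub>M N v"
    and sol: "AE \<omega> in P. \<forall>f\<in>F. phi f (restrict (\<lambda>v. Xstar W X h v \<omega>) (Vf f)) = c f"
  obtains g where "g \<in> PiM ((\<Union>f\<in>SF. Vf f) - SV) N \<rightarrow>\<^sub>M PiM SV N"
    "\<And>v. v \<in> SV \<Longrightarrow> AE \<omega> in P. Xstar W X h v \<omega> = g (joint_rv (Xstar W X h) ((\<Union>f\<in>SF. Vf f) - SV) \<omega>) v"
proof -
  let ?V = "\<Union>f\<in>SF. Vf f"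
  obtain g where SV: "SV \<subseteq> ?V - W" and g: "g \<in> PiM (?V - SV) N \<rightarrow>\<^sub>M PiM SV N"
    and ae: "AE \<omega> in P. \<forall>x \<in> space (PiM (?V - W) N).
          restrict x SV = g (comb W X \<omega> x (?V - SV)) \<longleftrightarrow> (\<forall>f\<in>SF. phi f (comb W X \<omega> x (Vf f)) = c f)"
    using us unfolding uniquely_solvable_wrt_def by blast
  have "Xstar W X h v \<omega> = g (joint_rv (Xstar W X h) (?V - SV) \<omega>) v"
    if v: "v \<in> SV" and \<omega>: "\<omega> \<in> space P"
      and uniq: "\<forall>x \<in> space (PiM (?V - W) N).
          restrict x SV = g (comb W X \<omega> x (?V - SV)) \<longleftrightarrow> (\<forall>f\<in>SF. phi f (comb W X \<omega> x (Vf f)) = c f)"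
      and sol': "\<forall>f\<in>F. phi f (restrict (\<lambda>v. Xstar W X h v \<omega>) (Vf f)) = c f" for v \<omega>
  proof -
    define x where "x = restrict (\<lambda>u. Xstar W X h u \<omega>) (?V - W)"
    have "Xstar W X h u \<omega> \<in> space (N u)" if "u \<in> ?V - W" for u
      using that SF(2) by (intro measurable_space[OF meas \<omega>]) auto
    then have x: "x \<in> space (PiM (?V - W) N)" by (auto simp: x_def space_PiM)
    have comb: "comb W X \<omega> x T = restrict (\<lambda>u. Xstar W X h u \<omega>) T" if "T \<subseteq> ?V" for T
      using that by (auto simp: comb_def x_def Xstar_def restrict_def fun_eq_iff)
    have "\<forall>f\<in>SF. phi f (comb W X \<omega> x (Vf f)) = c f"
    proof
      fix f assume "f \<in> SF"
      moreover from this have "comb W X \<omega> x (Vf f) = restrict (\<lambda>u. Xstar W X h u \<omega>) (Vf f)"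
        by (intro comb) auto
      ultimately show "phi f (comb W X \<omega> x (Vf f)) = c f" using sol' SF(1) by auto
    qed
    then have "restrict x SV = g (comb W X \<omega> x (?V - SV))" using uniq x by blast
    then have "x v = g (restrict (\<lambda>u. Xstar W X h u \<omega>) (?V - SV)) v"
      using comb[of "?V - SV"] v by (metis Diff_subset restrict_apply')
    moreover have "x v = Xstar W X h v \<omega>" using SV v by (auto simp: x_def)
    ultimately show ?thesis by (simp add: joint_rv_def)
  qed
  note eq = this
  have "AE \<omega> in P. Xstar W X h v \<omega> = g (joint_rv (Xstar W X h) (?V - SV) \<omega>) v" if v: "v \<in> SV" for v
    using ae sol AE_space
  proof eventually_elim
    case (elim \<omega>)
    show ?case by (rule eq[OF v elim(3) elim(1) elim(2)])
  qed
  then show thesis using that g by blast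
qed

theorem theorem17:
  fixes P :: "'w measure" and N :: "'v \<Rightarrow> 'x measure" and Y :: "'y measure"
    and V :: "'v set" and F :: "'f set" and W :: "'v set" and Vf :: "'f \<Rightarrow> 'v set"
    and X :: "'v \<Rightarrow> 'w \<Rightarrow> 'x" and phi :: "'f \<Rightarrow> ('v \<Rightarrow> 'x) \<Rightarrow> 'y" and c :: "'f \<Rightarrow> 'y"
    and h :: "('v \<Rightarrow> 'x) \<Rightarrow> ('v \<Rightarrow> 'x)"
    and M :: "('v \<times> 'f) set"
    and Cls :: "('v + 'f) set set" and Eds :: "(('v + 'f) \<times> ('v + 'f) set) set"
  assumes sys: "system_of_constraints P N Y V F W Vf X phi c"
    and sol: "is_solution P N V F W Vf X phi c h"
    and mm: "max_matching Vf (Inl ` (V - W) \<union> Inr ` F) M"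
    and co: "CO_graph Vf V F W M Cls Eds"
    and mus: "max_uniquely_solvable P N V F W Vf X phi c M Cls"
  shows "\<forall>A B C. A \<subseteq> CO_vertices Vf V F W M \<and> B \<subseteq> CO_vertices Vf V F W M \<and>
           C \<subseteq> CO_vertices Vf V F W M \<and>
           d_separated (induced_dmg (MO_graph Cls Eds) (CO_vertices Vf V F W M)) A B C \<longrightarrow>
           cond_indep P N (Xstar W X h) A B C"
proof -
  have V: "finite V" and WV: "W \<subseteq> V" and VfV: "\<And>f. f \<in> F \<Longrightarrow> Vf f \<subseteq> V"
    and prob: "prob_space P" and indep: "prob_space.indep_vars P N X W"
    using sys unfolding system_of_constraints_def by blast+
  interpret prob_space P by (rule prob)
  interpret causal_ordering Vf V W F M Cls Eds
    using WV VfV mm co by unfold_locales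
  let ?Z = "Xstar W X h"
  have h: "h \<in> PiM W N \<rightarrow>\<^sub>M PiM (V - W) N"
    and AE_sol: "AE \<omega> in P. \<forall>f\<in>F. phi f (restrict (\<lambda>v. ?Z v \<omega>) (Vf f)) = c f"
    using sol unfolding is_solution_def by blast+
  have X: "X w \<in> P \<rightarrow>\<^sub>M N w" if "w \<in> W" for w using indep that unfolding indep_vars_def by blast
  have meas: "?Z v \<in> P \<rightarrow>\<^sub>M N v" if "v \<in> V" for v using X h that by (rule measurable_Xstar)
  interpret random_family P N ?Z CV
    using meas CV_subset by unfold_locales blast
  have uniq: "uniquely_solvable_wrt P N W Vf X phi c (Inr -` S) (Inl -` S)"
    if "S \<in> Cls" "S \<inter> Inl ` W = {}" "S \<inter> TI = {}" for S
    using mus that unfolding max_uniquely_solvable_def Let_def U_def by blast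
  interpret deterministic_model P N ?Z CV MO_edges W
  proof
    show "finite CV" using CV_subset V by (rule finite_subset)
    show "MO_edges \<subseteq> CV \<times> CV" by (auto simp: MO_edges_def)
    show "acyclic MO_edges" by (rule acyclic_MO_edges)
    show "W \<subseteq> CV" by (auto simp: CV_iff)
    have "indep_vars N X W = indep_vars N ?Z W"
      by (intro indep_vars_cong) (auto simp: Xstar_def fun_eq_iff)
    then show "indep_vars N ?Z W" using indep by simp
    fix v assume v: "v \<in> CV - W"
    obtain S where S: "S \<in> Cls" "Inl v \<in> S" "S \<subseteq> U" "S \<inter> TI = {}"
      and edges: "\<And>f u. Inr f \<in> S \<Longrightarrow> u \<in> Vf f \<Longrightarrow> Inl u \<notin> S \<Longrightarrow> (u, v) \<in> MO_edges"
      using cluster_of_endogenous[OF v] by blast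
    \<comment> \<open>All variables of the cluster's constraints that lie outside the cluster,
      exogenous ones included: the arguments of its solution function.\<close>
    let ?PA = "(\<Union>f\<in>Inr -` S. Vf f) - Inl -` S"
    have "S \<inter> Inl ` W = {}" using S(3) by (auto simp: U_def)
    then have us: "uniquely_solvable_wrt P N W Vf X phi c (Inr -` S) (Inl -` S)" using uniq S by blast
    have SF: "Inr -` S \<subseteq> F" using S(3) Inr_U by blast
    then have Vf_SF: "\<And>f. f \<in> Inr -` S \<Longrightarrow> Vf f \<subseteq> V" using VfV by blast
    obtain g where g: "g \<in> PiM ?PA N \<rightarrow>\<^sub>M PiM (Inl -` S) N"
      and g_AE: "\<And>v. v \<in> Inl -` S \<Longrightarrow> AE \<omega> in P. ?Z v \<omega> = g (joint_rv ?Z ?PA \<omega>) v"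
      by (rule uniquely_solvable_wrt_Xstar[OF us SF Vf_SF meas AE_sol]) blast+
    have PA: "?PA \<subseteq> {u. (u, v) \<in> MO_edges}" using edges by blast
    then have "?PA \<subseteq> CV" by (auto simp: MO_edges_def)
    moreover have "v \<in> Inl -` S" using S(2) by simp
    ultimately have "le {v} ?PA" using g g_AE by (intro ae_subsumed_if_AE_eq)
    then show "le {v} {u. (u, v) \<in> MO_edges}" using ae_subsumed_refl[OF PA] by (rule ae_subsumed_trans)
  qed
  show ?thesis
    unfolding induced_MO_graph using global_markov by blast
qed

end
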